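(* Let $D$ be an integer-valued random variable with $D\ge2$ a.s. whose distribution function $F(x)=\mathbb P(D\le x)$ satisfies $1-F(x)=x^{1-\tau}L(x)$ with $\tau\in(2,3)$ and $L$ slowly varying at infinity. Let $$\widehat D=1+\sum_{i=1}^{D}\mathbf 1_{\{V_i-E_i>\xi\}},\qquad \xi=\min_{1\le i\le D}(V_i+E_i),$$ where $D$, $(V_i)_{i\ge1}$, $(E_i)_{i\ge1}$ are independent, the $V_i$ are i.i.d. copies of the variable $V$ defined in the context and the $E_i$ are i.i.d. mean-one exponential variables ($\widehat D$ is the limiting degree of a uniform vertex in the shortest path tree of the configuration model with i.i.d. degrees distributed as $D$ and mean-one exponential edge weights). Let $p=\mathbb P(V>E)$, with $E$ a mean-one exponential variable independent of $V$. Then: (a) conditional on $\{D=k\}$, $\widehat D=p\cdot D\cdot(1+o_{\mathbb P}(1))$ in the limit $k\to\infty$; (b) the distribution function $\widehat F$ of $\widehat D$ satisfies $1-\widehat F(x)=x^{1-\tau}\widehat L(x)$ for the same $\tau$ and some function $\widehat L$ slowly varying at infinity.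
   Context: The size-biased variable $D^\star$ has $\mathbb P(D^\star=k)=k\,\mathbb P(D=k)/\mathbb E(D)$. $V$ is the a.s. finite positive random variable with law given by $$V\overset{d}{=}\sum_{i=1}^\infty\frac{E_i}{1+\sum_{j=1}^i(D^\star_j-2)},$$ with $(E_i)$ i.i.d. mean-one exponential and, independently, $(D^\star_j)$ i.i.d. copies of $D^\star$. Limits $k\to\infty$ are along values with $\mathbb P(D=k)>0$; $o_{\mathbb P}(1)$ denotes a quantity converging to $0$ in (conditional) probability. *)

theory Defs
  imports "HOL-Probability.Probability"
begin

definition slowly_varying :: "(real \<Rightarrow> real) \<Rightarrow> bool" where
  "slowly_varying L \<longleftrightarrow>
     (\<exists>x0. L \<in> borel_measurable (restrict_space borel {x0..}) \<and> (\<forall>x\<ge>x0. 0 < L x)) \<and>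
     (\<forall>c>0. ((\<lambda>x. L (c * x) / L x) \<longlongrightarrow> 1) at_top)"

definition exp1 :: "real measure" where
  "exp1 = density lborel (exponential_density 1)"

definition size_biased :: "nat measure \<Rightarrow> nat measure" where
  "size_biased \<mu> =
     density (count_space UNIV) (\<lambda>k. real k * measure \<mu> {k} / (\<integral>n. real n \<partial>\<mu>))"

text \<open>
  The law of \<open>V\<close> when \<open>D\<close> has law \<open>\<mu>\<close>. The series of (almost surely) nonnegative terms is taken
  in \<open>[0, \<infinity>]\<close>, so that it is defined everywhere; \<open>V\<close> is real valued, so having this law means
  that \<open>ennreal V\<close> has it. Strict positivity of \<open>V\<close> follows, as the first term of the series is
  almost surely positive.
\<close>

definition V_series :: "(nat \<Rightarrow> real) \<Rightarrow> (nat \<Rightarrow> nat) \<Rightarrow> ennreal" where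
  "V_series e d = (\<Sum>i. ennreal (e (Suc i) / (1 + (\<Sum>j=1..Suc i. (real (d j) - 2)))))"

definition V_law :: "nat measure \<Rightarrow> ennreal measure" where
  "V_law \<mu> =
     distr (PiM {1..} (\<lambda>_. exp1) \<Otimes>\<^sub>M PiM {1..} (\<lambda>_. size_biased \<mu>)) borel
       (\<lambda>(e, d). V_series e d)"

definition prob_V_gt_E :: "nat measure \<Rightarrow> real" where
  "prob_V_gt_E \<mu> = measure (V_law \<mu> \<Otimes>\<^sub>M exp1) {(v, e). ennreal e < v}"

text \<open>
  The minimum \<open>\<xi>\<close> and the degree in the shortest path tree, for the degree \<open>n\<close> and the
  sequences \<open>v\<close>, \<open>e\<close>, of which only the entries \<open>1..n\<close> matter. For \<open>n = 0\<close> (a null event) the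
  minimum is unspecified.
\<close>

definition hitting_time :: "nat \<Rightarrow> (nat \<Rightarrow> real) \<Rightarrow> (nat \<Rightarrow> real) \<Rightarrow> real" where
  "hitting_time n v e = Min ((\<lambda>i. v i + e i) ` {1..n})"

definition spt_degree :: "nat \<Rightarrow> (nat \<Rightarrow> real) \<Rightarrow> (nat \<Rightarrow> real) \<Rightarrow> nat" where
  "spt_degree n v e = 1 + (\<Sum>i=1..n. of_bool (v i - e i > hitting_time n v e))"

end

theory Submission
  imports Defs "HOL-Real_Asymp.Real_Asymp"
begin

text \<open>
  Given \<open>D = k\<close>, the degree is one plus the number of \<open>i \<le> k\<close> with \<open>V\<^sub>i - E\<^sub>i > \<xi>\<close>. Almost surely
  \<open>\<xi> > 0\<close>, so this number is at most the number of \<open>i \<le> k\<close> with \<open>E\<^sub>i < V\<^sub>i\<close>. Since \<open>0\<close> is in the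
  support of \<open>V\<close>, also \<open>\<xi> < \<delta>\<close> with high probability for each \<open>\<delta> > 0\<close>, so it is then at least the
  number of \<open>i \<le> k\<close> with \<open>V\<^sub>i - E\<^sub>i > \<delta>\<close>. Both are sums of independent indicators, and
  Hoeffding's inequality gives (a). For (b), the lower bound on the tail of the degree comes from (a).
  In the upper bound, the event that the degree exceeds \<open>x\<close> although \<open>D \<le> (1 - \<eta>) x / p\<close> has
  probability exponentially small in \<open>x\<close>, which is negligible against a regularly varying tail.
\<close>

section \<open>Regularly varying functions\<close>

text \<open>That 0 lies in the support of \<open>V\<close> is not evident from the series, whose
  terms share their denominators. Freezing the degrees turns it into a weighted sum of independent
  exponentials with weights in (0,1]; its remainder is small because \<open>V\<close> is finite, and
  finiteness holds since \<open>V\<close> is real valued. The two tail bounds are asymmetric. Below,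
  a conditional probability close to 1 for every large k is enough. The exponential error is
  compared with the tail through monotonicity and a single dilation factor, without a representation
  of slowly varying functions. Rescaling x to x / p makes the ratio of the two tails tend to p to
  the power \<tau> - 1. The condition \<tau> > 2 gives \<open>D\<close> a finite mean, which makes
  the size-biased law a probability measure.\<close>

definition regularly_varying :: "real \<Rightarrow> (real \<Rightarrow> real) \<Rightarrow> bool" where
  "regularly_varying \<rho> T \<longleftrightarrow> (\<forall>\<^sub>F x in at_top. 0 < T x) \<and>
     (\<forall>c>0. ((\<lambda>x. T (c * x) / T x) \<longlongrightarrow> c powr \<rho>) at_top)"

lemma regularly_varyingD:
  assumes "regularly_varying \<rho> T"
  shows "\<forall>\<^sub>F x in at_top. 0 < T x"
    and "c > 0 \<Longrightarrow> ((\<lambda>x. T (c * x) / T x) \<longlongrightarrow> c powr \<rho>) at_top"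
  using assms by (auto simp: regularly_varying_def)

lemma regularly_varying_powr_times:
  assumes "slowly_varying L" and T: "\<And>x. 0 < x \<Longrightarrow> T x = x powr \<rho> * L x"
  shows "regularly_varying \<rho> T"
  unfolding regularly_varying_def
proof (intro conjI allI impI)
  obtain x0 where x0: "\<And>x. x \<ge> x0 \<Longrightarrow> 0 < L x"
    using assms(1) by (auto simp: slowly_varying_def)
  show "\<forall>\<^sub>F x in at_top. 0 < T x"
    using eventually_ge_at_top[of x0] eventually_gt_at_top[of 0]
    by eventually_elim (use x0 T in auto)
next
  fix c :: real assume c: "c > 0"
  have "((\<lambda>x. c powr \<rho> * (L (c * x) / L x)) \<longlongrightarrow> c powr \<rho> * 1) at_top"
    using assms(1) c by (intro tendsto_intros) (auto simp: slowly_varying_def)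
  moreover have "\<forall>\<^sub>F x in at_top. c powr \<rho> * (L (c * x) / L x) = T (c * x) / T x"
    using eventually_gt_at_top[of 0]
    by eventually_elim (use c in \<open>simp add: T powr_mult\<close>)
  ultimately show "((\<lambda>x. T (c * x) / T x) \<longlongrightarrow> c powr \<rho>) at_top"
    by (simp add: tendsto_cong)
qed

lemma regularly_varying_ratio_limit:
  assumes T: "regularly_varying \<rho> T" and lim: "((\<lambda>x. S x / T x) \<longlongrightarrow> K) at_top" and K: "K > 0"
  shows "regularly_varying \<rho> S"
  unfolding regularly_varying_def
proof (intro conjI allI impI)
  have "\<forall>\<^sub>F x in at_top. 0 < S x / T x"
    using lim K by (rule order_tendstoD)
  then show S: "\<forall>\<^sub>F x in at_top. 0 < S x"
    using regularly_varyingD(1)[OF T] by eventually_elim (auto simp: zero_less_divide_iff)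
  fix c :: real assume c: "c > 0"
  have at: "filterlim (\<lambda>x. c * x) at_top at_top"
    using c by real_asymp
  have "((\<lambda>x. (S (c * x) / T (c * x)) * (T (c * x) / T x) / (S x / T x)) \<longlongrightarrow> K * c powr \<rho> / K) at_top"
    using K c by (intro tendsto_intros lim regularly_varyingD(2)[OF T] filterlim_compose[OF lim at]) auto
  moreover have "\<forall>\<^sub>F x in at_top. (S (c * x) / T (c * x)) * (T (c * x) / T x) / (S x / T x) = S (c * x) / S x"
    using regularly_varyingD(1)[OF T] S eventually_compose_filterlim[OF regularly_varyingD(1)[OF T] at]
    by eventually_elim auto
  ultimately have "((\<lambda>x. S (c * x) / S x) \<longlongrightarrow> K * c powr \<rho> / K) at_top"
    by (rule Lim_transform_eventually)
  then show "((\<lambda>x. S (c * x) / S x) \<longlongrightarrow> c powr \<rho>) at_top"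
    using K by simp
qed

text \<open>A fixed dilation factor \<eta> > 1 costs \<open>T\<close> a factor close to \<eta> to
  the power \<rho>. For large x the unit step to x + 1 is shorter than this dilation, so by
  monotonicity it costs no more. Iterating unit steps shows that \<open>T\<close> decays no faster
  than exp (- (c / 2) x).\<close>

lemma exp_negligible_regularly_varying:
  assumes T: "regularly_varying \<rho> T" and "antimono T" and "\<rho> < 0" and c: "c > 0"
  shows "((\<lambda>x. exp (- c * x) / T x) \<longlongrightarrow> 0) at_top"
proof -
  \<comment> \<open>Solves \<eta> powr \<rho> = exp (- c / 4), which leaves room above the bound exp
    (- c / 2) used next.\<close>
  define \<eta> where "\<eta> = exp (c / (4 * - \<rho>))"
  have \<eta>: "\<eta> > 1" "\<eta> powr \<rho> = exp (- c / 4)"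
    using \<open>\<rho> < 0\<close> c by (auto simp: \<eta>_def powr_def zero_less_mult_iff divide_less_0_iff field_simps)
  have "\<forall>\<^sub>F x in at_top. exp (- c / 2) < T (\<eta> * x) / T x"
    using \<eta> c by (intro order_tendstoD(1)[OF regularly_varyingD(2)[OF T]]) auto
  moreover have "\<forall>\<^sub>F x in at_top. x + 1 \<le> \<eta> * x"
    using \<eta> by real_asymp
  ultimately have "\<forall>\<^sub>F x in at_top. 0 < T x \<and> exp (- c / 2) * T x \<le> T (x + 1)"
    using regularly_varyingD(1)[OF T]
  proof eventually_elim
    case (elim x)
    then have "exp (- c / 2) * T x \<le> T (\<eta> * x)"
      by (simp add: field_simps)
    also have "\<dots> \<le> T (x + 1)"
      using elim by (intro antimonoD[OF \<open>antimono T\<close>])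
    finally show ?case using elim by simp
  qed
  then obtain x0 where x0: "\<And>x. x \<ge> x0 \<Longrightarrow> 0 < T x"
      "\<And>x. x \<ge> x0 \<Longrightarrow> exp (- c / 2) * T x \<le> T (x + 1)"
    by (auto simp: eventually_at_top_linorder)
  have step: "exp (- (c / 2) * real n) * T x0 \<le> T (x0 + real n)" for n
  proof (induction n)
    case (Suc n)
    have "exp (- (c / 2) * real (Suc n)) * T x0 = exp (- c / 2) * (exp (- (c / 2) * real n) * T x0)"
      by (simp add: algebra_simps flip: exp_add)
    also have "\<dots> \<le> exp (- c / 2) * T (x0 + real n)"
      using Suc by (intro mult_left_mono) auto
    also have "\<dots> \<le> T (x0 + real n + 1)"
      by (intro x0) auto
    finally show ?case by (simp add: algebra_simps)
  qed simp
  \<comment> \<open>Rounding x - x0 up to an integer overshoots by at most 1; this is the + 1 in the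
    exponent.\<close>
  have lower: "exp (- (c / 2) * (x - x0 + 1)) * T x0 \<le> T x" if "x \<ge> x0" for x
  proof -
    have "real (nat \<lceil>x - x0\<rceil>) \<le> x - x0 + 1"
      using that by linarith
    then have "exp (- (c / 2) * (x - x0 + 1)) * T x0 \<le> exp (- (c / 2) * real (nat \<lceil>x - x0\<rceil>)) * T x0"
      using c x0(1)[of x0] by (intro mult_right_mono) auto
    also have "\<dots> \<le> T (x0 + real (nat \<lceil>x - x0\<rceil>))"
      by (rule step)
    also have "\<dots> \<le> T x"
      using that by (intro antimonoD[OF \<open>antimono T\<close>]) linarith
    finally show ?thesis .
  qed
  show ?thesis
  proof (rule tendsto_sandwich[OF _ _ tendsto_const])
    show "\<forall>\<^sub>F x in at_top. 0 \<le> exp (- c * x) / T x"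
      using regularly_varyingD(1)[OF T] by eventually_elim auto
    show "\<forall>\<^sub>F x in at_top. exp (- c * x) / T x \<le> exp (- c * x) / (exp (- (c / 2) * (x - x0 + 1)) * T x0)"
      using eventually_ge_at_top[of x0]
      by eventually_elim (use x0(1) lower in \<open>auto intro!: divide_left_mono mult_pos_pos\<close>)
    show "((\<lambda>x. exp (- c * x) / (exp (- (c / 2) * (x - x0 + 1)) * T x0)) \<longlongrightarrow> 0) at_top"
      using c x0(1)[of x0] by real_asymp
  qed
qed

text \<open>After division by T x the bounds confine S x / T x asymptotically between (1 - \<eta>)
  ((1 + \<eta>) q) powr \<rho> and ((1 - \<eta>) q) powr \<rho>. Both tend to q powr \<rho> as
  \<eta> decreases to 0, so \<open>S\<close> is asymptotic to a constant multiple of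
  \<open>T\<close>.\<close>

lemma regularly_varying_sandwich:
  assumes T: "regularly_varying \<rho> T" "antimono T" "\<rho> < 0" and q: "q > 0"
    and upper: "\<And>\<eta>. 0 < \<eta> \<Longrightarrow> \<eta> < 1 \<Longrightarrow> \<exists>c>0. \<forall>\<^sub>F x in at_top. S x \<le> T ((1 - \<eta>) * q * x) + exp (- c * x)"
    and lower: "\<And>\<eta>. 0 < \<eta> \<Longrightarrow> \<eta> < 1 \<Longrightarrow> \<forall>\<^sub>F x in at_top. (1 - \<eta>) * T ((1 + \<eta>) * q * x) \<le> S x"
  shows "regularly_varying \<rho> S"
proof (rule regularly_varying_ratio_limit[OF T(1)])
  note T0 = regularly_varyingD(1)[OF T(1)]
  have small: "\<forall>\<^sub>F \<eta> in at_right (0::real). 0 < \<eta> \<and> \<eta> < 1"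
    by (auto simp: eventually_at_right_field intro!: exI[of _ 1])
  show "((\<lambda>x. S x / T x) \<longlongrightarrow> q powr \<rho>) at_top"
  proof (rule order_tendstoI)
    fix a assume a: "a < q powr \<rho>"
    have "((\<lambda>\<eta>. (1 - \<eta>) * ((1 + \<eta>) * q) powr \<rho>) \<longlongrightarrow> (1 - 0) * ((1 + 0) * q) powr \<rho>) (at_right 0)"
      using q by (intro tendsto_intros) auto
    then have "\<forall>\<^sub>F \<eta> in at_right 0. a < (1 - \<eta>) * ((1 + \<eta>) * q) powr \<rho>"
      using a by (intro order_tendstoD) auto
    with small have "\<forall>\<^sub>F \<eta> in at_right 0. 0 < \<eta> \<and> \<eta> < 1 \<and> a < (1 - \<eta>) * ((1 + \<eta>) * q) powr \<rho>"
      by eventually_elim auto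
    then obtain \<eta> where \<eta>: "0 < \<eta>" "\<eta> < 1" "a < (1 - \<eta>) * ((1 + \<eta>) * q) powr \<rho>"
      using eventually_happens'[OF trivial_limit_at_right_real] by blast
    have "((\<lambda>x. (1 - \<eta>) * (T ((1 + \<eta>) * q * x) / T x)) \<longlongrightarrow> (1 - \<eta>) * ((1 + \<eta>) * q) powr \<rho>) at_top"
      using \<eta> q by (intro tendsto_intros regularly_varyingD(2)[OF T(1)]) auto
    then have "\<forall>\<^sub>F x in at_top. a < (1 - \<eta>) * (T ((1 + \<eta>) * q * x) / T x)"
      using \<eta> by (intro order_tendstoD)
    with lower[OF \<eta>(1,2)] T0 show "\<forall>\<^sub>F x in at_top. a < S x / T x"
    proof eventually_elim
      case (elim x)
      have "a < (1 - \<eta>) * T ((1 + \<eta>) * q * x) / T x" using elim by simp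
      also have "\<dots> \<le> S x / T x" using elim by (intro divide_right_mono) auto
      finally show ?case .
    qed
  next
    fix a assume a: "q powr \<rho> < a"
    have "((\<lambda>\<eta>. ((1 - \<eta>) * q) powr \<rho>) \<longlongrightarrow> ((1 - 0) * q) powr \<rho>) (at_right 0)"
      using q by (intro tendsto_intros) auto
    then have "\<forall>\<^sub>F \<eta> in at_right 0. ((1 - \<eta>) * q) powr \<rho> < a"
      using a by (intro order_tendstoD) auto
    with small have "\<forall>\<^sub>F \<eta> in at_right 0. 0 < \<eta> \<and> \<eta> < 1 \<and> ((1 - \<eta>) * q) powr \<rho> < a"
      by eventually_elim auto
    then obtain \<eta> where \<eta>: "0 < \<eta>" "\<eta> < 1" "((1 - \<eta>) * q) powr \<rho> < a"
      using eventually_happens'[OF trivial_limit_at_right_real] by blast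
    obtain c where c: "c > 0" "\<forall>\<^sub>F x in at_top. S x \<le> T ((1 - \<eta>) * q * x) + exp (- c * x)"
      using upper[OF \<eta>(1,2)] by blast
    have "((\<lambda>x. T ((1 - \<eta>) * q * x) / T x + exp (- c * x) / T x) \<longlongrightarrow> ((1 - \<eta>) * q) powr \<rho> + 0) at_top"
      using \<eta> q c by (intro tendsto_add exp_negligible_regularly_varying[OF T] regularly_varyingD(2)[OF T(1)]) auto
    then have "\<forall>\<^sub>F x in at_top. T ((1 - \<eta>) * q * x) / T x + exp (- c * x) / T x < a"
      using \<eta> by (intro order_tendstoD) auto
    with c(2) T0 show "\<forall>\<^sub>F x in at_top. S x / T x < a"
    proof eventually_elim
      case (elim x)
      have "S x / T x \<le> (T ((1 - \<eta>) * q * x) + exp (- c * x)) / T x"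
        using elim by (intro divide_right_mono) auto
      also have "\<dots> < a" using elim by (simp add: add_divide_distrib)
      finally show ?case .
    qed
  qed
  show "q powr \<rho> > 0" using q by simp
qed

lemma slowly_varying_of_regularly_varying:
  assumes T: "regularly_varying \<rho> T" and meas: "T \<in> borel_measurable borel"
  shows "slowly_varying (\<lambda>x. x powr (- \<rho>) * T x)"
  unfolding slowly_varying_def
proof (intro conjI allI impI)
  have "\<forall>\<^sub>F x in at_top. 0 < x \<and> 0 < T x"
    using regularly_varyingD(1)[OF T] eventually_gt_at_top[of 0] by eventually_elim auto
  then obtain x0 where x0: "\<And>x. x \<ge> x0 \<Longrightarrow> 0 < x \<and> 0 < T x"
    by (auto simp: eventually_at_top_linorder)
  have "0 < x powr (- \<rho>) * T x" if "x \<ge> x0" for x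
    using x0[OF that] by simp
  then show "\<exists>x0. (\<lambda>x. x powr (- \<rho>) * T x) \<in> borel_measurable (restrict_space borel {x0..}) \<and>
      (\<forall>x\<ge>x0. 0 < x powr (- \<rho>) * T x)"
    using meas by (intro exI[of _ x0]) (auto intro!: measurable_restrict_space1)
next
  fix c :: real assume c: "c > 0"
  have "((\<lambda>x. c powr (- \<rho>) * (T (c * x) / T x)) \<longlongrightarrow> c powr (- \<rho>) * c powr \<rho>) at_top"
    using c by (intro tendsto_intros regularly_varyingD(2)[OF T]) auto
  moreover have "\<forall>\<^sub>F x in at_top. c powr (- \<rho>) * (T (c * x) / T x)
      = ((c * x) powr (- \<rho>) * T (c * x)) / (x powr (- \<rho>) * T x)"
    using eventually_gt_at_top[of 0] by eventually_elim (use c in \<open>simp add: powr_mult\<close>)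
  ultimately show "((\<lambda>x. ((c * x) powr (- \<rho>) * T (c * x)) / (x powr (- \<rho>) * T x)) \<longlongrightarrow> 1) at_top"
    using c by (simp add: tendsto_cong powr_minus field_simps)
qed

text \<open>Cauchy condensation: the condensed terms 2^n T (2^n) have successive ratios tending to 2
  * 2 powr \<rho>, which is below 1 exactly when \<rho> < - 1.\<close>

lemma summable_regularly_varying:
  assumes T: "regularly_varying \<rho> T" "antimono T" "\<And>x. 0 \<le> T x" and \<rho>: "\<rho> < - 1"
  shows "summable (\<lambda>n. T (real n))"
proof -
  obtain r where r: "2 * 2 powr \<rho> < r" "r < (1::real)"
  proof -
    have "2 * 2 powr \<rho> < 2 * 2 powr (-1::real)" using \<rho> by (intro mult_strict_left_mono powr_less_mono) auto
    then show ?thesis using that dense by force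
  qed
  have "\<forall>\<^sub>F x in at_top. T (2 * x) / T x < r / 2"
    using r by (intro order_tendstoD(2)[OF regularly_varyingD(2)[OF T(1)]]) auto
  then have "\<forall>\<^sub>F x in at_top. 2 * T (2 * x) \<le> r * T x"
    using regularly_varyingD(1)[OF T(1)] by eventually_elim (simp add: field_simps)
  moreover have "filterlim (\<lambda>n. 2 ^ n :: real) at_top sequentially"
    by real_asymp
  ultimately have "\<forall>\<^sub>F n in sequentially. 2 * T (2 * 2 ^ n) \<le> r * T (2 ^ n)"
    by (rule eventually_compose_filterlim)
  then obtain N where N: "\<And>n. n \<ge> N \<Longrightarrow> 2 * T (2 * 2 ^ n) \<le> r * T (2 ^ n)"
    by (auto simp: eventually_sequentially)
  have "summable (\<lambda>n. 2 ^ n * T (real (2 ^ n)))"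
  proof (rule summable_ratio_test)
    fix n assume "n \<ge> N"
    from mult_left_mono[OF N[OF this], of "2 ^ n"]
    show "norm (2 ^ Suc n * T (real (2 ^ Suc n))) \<le> r * norm (2 ^ n * T (real (2 ^ n)))"
      using T(3) by (simp add: abs_mult mult_ac)
  qed (use r in auto)
  then show ?thesis
    by (subst condensation_test) (auto intro!: T(3) antimonoD[OF T(2)])
qed

section \<open>The law of \<open>V\<close>\<close>

declare One_nat_def [simp del]

section \<open>The exponential law and independence of coordinates\<close>

lemma prob_space_exp1: "prob_space exp1"
  unfolding exp1_def by (rule prob_space_exponential_density) simp

lemma sets_exp1 [simp, measurable_cong]: "sets exp1 = sets borel"
  and space_exp1 [simp]: "space exp1 = UNIV"
  by (simp_all add: exp1_def)

lemma measure_exp1_atMost: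
  assumes "0 \<le> a"
  shows "measure exp1 {..a} = 1 - exp (- a)"
proof -
  interpret prob_space exp1 by (rule prob_space_exp1)
  have "distr exp1 lborel (\<lambda>x. x) = exp1"
    by (intro distr_id2) (simp add: exp1_def)
  then have "distributed exp1 lborel (\<lambda>x. x) (exponential_density 1)"
    by (simp add: distributed_def exp1_def)
  from exponential_distributedD_le[OF this assms] show ?thesis
    by (simp add: atMost_def)
qed

lemma AE_exp1_pos: "AE x in exp1. 0 < x"
proof -
  interpret prob_space exp1 by (rule prob_space_exp1)
  have "measure exp1 {..0} = 0" by (simp add: measure_exp1_atMost)
  then have "AE x in exp1. x \<notin> {..0}"
    by (intro AE_not_in) (auto simp: null_sets_def emeasure_eq_measure)
  then show ?thesis by eventually_elim auto
qed

lemma measure_exp1_lessThan_pos: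
  assumes "0 < c"
  shows "0 < measure exp1 {..<c}"
proof -
  interpret prob_space exp1 by (rule prob_space_exp1)
  have "0 < measure exp1 {..c / 2}"
    using assms by (simp add: measure_exp1_atMost)
  also have "\<dots> \<le> measure exp1 {..<c}"
    using assms by (intro finite_measure_mono) auto
  finally show ?thesis .
qed

text \<open>The joint law of all coordinates is the law of the identity, that is, the product
  measure, whose marginals are its factors. It serves to separate the first exponentials from the
  later ones.\<close>

lemma (in product_prob_space) indep_vars_PiM_coordinates:
  assumes "I \<noteq> {}"
  shows "indep_vars M (\<lambda>i x. x i) I"
proof -
  have "distr (PiM I M) (PiM I M) (\<lambda>x. \<lambda>i\<in>I. x i) = PiM I M"
    by (subst distr_cong[OF refl refl, where g = "\<lambda>x. x"])
       (auto simp: space_PiM restrict_PiE_iff PiE_restrict intro!: distr_id2)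
  moreover have "(\<Pi>\<^sub>M i\<in>I. distr (PiM I M) (M i) (\<lambda>x. x i)) = PiM I M"
    by (intro PiM_cong refl distr_PiM_component prob_space)
  ultimately show ?thesis
    using assms by (subst indep_vars_iff_distr_eq_PiM') auto
qed

section \<open>The size-biased law\<close>

text \<open>Expresses integrals and null sets of \<open>\<mu>\<close> through point masses, the form
  in which \<open>size_biased\<close> is defined.\<close>

lemma density_eq_measure_nat:
  fixes \<mu> :: "nat measure"
  assumes "finite_measure \<mu>" "sets \<mu> = UNIV"
  shows "density (count_space UNIV) (\<lambda>k. ennreal (measure \<mu> {k})) = \<mu>"
proof (rule measure_eqI_countable[of _ UNIV])
  interpret finite_measure \<mu> by fact
  fix k :: nat
  have "(\<integral>\<^sup>+j. ennreal (measure \<mu> {j}) * indicator {k} j \<partial>count_space UNIV) = emeasure \<mu> {k}"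
    by (simp add: emeasure_eq_measure nn_integral_indicator_singleton')
  then show "emeasure (density (count_space UNIV) (\<lambda>k. ennreal (measure \<mu> {k}))) {k} = emeasure \<mu> {k}"
    by (simp add: emeasure_density)
qed (use assms in auto)

text \<open>The mean times the total mass is again the mean; it cancels because it is positive and
  finite.\<close>

lemma prob_space_size_biased:
  fixes \<mu> :: "nat measure"
  assumes "finite_measure \<mu>" and sets: "sets \<mu> = UNIV"
    and int: "integrable \<mu> real" and pos: "0 < (\<integral>n. real n \<partial>\<mu>)"
  shows "prob_space (size_biased \<mu>)"
proof
  let ?m = "\<integral>n. real n \<partial>\<mu>"
  have "ennreal ?m = (\<integral>\<^sup>+k. ennreal (real k) \<partial>\<mu>)"
    using int by (subst nn_integral_eq_integral) auto
  also have "\<dots> = (\<integral>\<^sup>+k. ennreal (real k) \<partial>density (count_space UNIV) (\<lambda>k. ennreal (measure \<mu> {k})))"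
    by (simp add: density_eq_measure_nat[OF assms(1) sets])
  also have "\<dots> = (\<integral>\<^sup>+k. ennreal ?m * ennreal (real k * measure \<mu> {k} / ?m) \<partial>count_space UNIV)"
    using pos by (subst nn_integral_density)
      (auto intro!: nn_integral_cong simp: mult.commute simp flip: ennreal_mult)
  also have "\<dots> = ennreal ?m * emeasure (size_biased \<mu>) (space (size_biased \<mu>))"
    by (simp add: size_biased_def emeasure_density nn_integral_cmult)
  finally have "ennreal ?m * 1 = ennreal ?m * emeasure (size_biased \<mu>) (space (size_biased \<mu>))"
    by simp
  then show "emeasure (size_biased \<mu>) (space (size_biased \<mu>)) = 1"
    using pos by (subst (asm) ennreal_mult_cancel_left) auto
qed

lemma sets_size_biased [simp, measurable_cong]: "sets (size_biased \<mu>) = sets (count_space UNIV)"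
  and space_size_biased [simp]: "space (size_biased \<mu>) = UNIV"
  by (simp_all add: size_biased_def)

text \<open>Size biasing is absolutely continuous: it charges only points that already have positive
  mass.\<close>

lemma AE_size_biased:
  assumes "finite_measure \<mu>" and sets: "sets \<mu> = UNIV" and "AE k in \<mu>. P k"
  shows "AE k in size_biased \<mu>. P k"
proof -
  have "AE k in density (count_space UNIV) (\<lambda>k. ennreal (measure \<mu> {k})). P k"
    by (subst density_eq_measure_nat[OF assms(1) sets]) (rule assms(3))
  then have P: "0 < measure \<mu> {k} \<longrightarrow> P k" for k
    by (simp add: AE_density AE_count_space)
  have "P k" if "0 < real k * measure \<mu> {k} / (\<integral>n. real n \<partial>\<mu>)" for k
  proof -
    have "measure \<mu> {k} \<noteq> 0" using that by auto
    then show ?thesis using P[of k] by (simp add: zero_less_measure_iff)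
  qed
  then show ?thesis
    unfolding size_biased_def by (subst AE_density) (auto simp: AE_count_space)
qed

section \<open>Small values of a weighted exponential series\<close>

lemma AE_exp1_series_tail_small:
  fixes w :: "nat \<Rightarrow> real"
  assumes w: "\<And>i. 0 \<le> w i" and \<delta>: "0 < \<delta>"
    and fin: "AE e in PiM {1..} (\<lambda>_. exp1). (\<Sum>i. ennreal (e (Suc i) * w i)) < \<infinity>"
  shows "AE e in PiM {1..} (\<lambda>_. exp1). \<exists>n. (\<Sum>i. ennreal (e (Suc (i + n)) * w (i + n))) < ennreal \<delta>"
proof -
  have "AE e in PiM {1..} (\<lambda>_. exp1). \<forall>i. 0 < e (Suc i)"
    by (subst AE_all_countable) (auto intro!: AE_PiM_component AE_exp1_pos prob_space_exp1)
  with fin show ?thesis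
  proof eventually_elim
    case (elim e)
    have nonneg: "0 \<le> e (Suc i) * w i" for i
      using elim w by (simp add: less_imp_le)
    have sm: "summable (\<lambda>i. e (Suc i) * w i)"
      using elim nonneg by (intro summable_suminf_not_top) auto
    from suminf_exist_split[OF \<delta> this] obtain n
      where n: "norm (\<Sum>i. e (Suc (i + n)) * w (i + n)) < \<delta>" by auto
    have "(\<Sum>i. ennreal (e (Suc (i + n)) * w (i + n))) = ennreal (\<Sum>i. e (Suc (i + n)) * w (i + n))"
      using nonneg summable_ignore_initial_segment[OF sm, of n] by (intro suminf_ennreal2) auto
    also have "\<dots> < ennreal \<delta>"
      using n \<delta> by (intro ennreal_lessI) auto
    finally show ?case by blast
  qed
qed

text \<open>
  The terms up to a suitable index \<open>n\<close> and the remainder are independent, and each of the two parts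
  is below \<open>\<delta> / 2\<close> with positive probability.
\<close>

lemma exp1_series_small_not_null:
  fixes w :: "nat \<Rightarrow> real"
  assumes w: "\<And>i. 0 \<le> w i" "\<And>i. w i \<le> 1" and \<delta>: "0 < \<delta>"
    and fin: "AE e in PiM {1..} (\<lambda>_. exp1). (\<Sum>i. ennreal (e (Suc i) * w i)) < \<infinity>"
  shows "\<not> (AE e in PiM {1..} (\<lambda>_. exp1). \<not> (\<Sum>i. ennreal (e (Suc i) * w i)) < ennreal \<delta>)"
proof
  assume null: "AE e in PiM {1..} (\<lambda>_. exp1). \<not> (\<Sum>i. ennreal (e (Suc i) * w i)) < ennreal \<delta>"
  interpret product_prob_space "\<lambda>_. exp1" "{1::nat..}"
    by (intro product_prob_spaceI prob_space_exp1)
  let ?P = "PiM {1::nat..} (\<lambda>_. exp1)"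
  let ?tail = "\<lambda>n e. \<Sum>i. ennreal (e (Suc (i + n)) * w (i + n))"
  \<comment> \<open>The index at which the tail becomes small is random. If smallness were a null
    event for each fixed n, it would be null for all n at once by countability, so some
    deterministic n works.\<close>
  have "\<exists>n. \<not> (AE e in ?P. \<not> ?tail n e < ennreal (\<delta> / 2))"
  proof (rule ccontr)
    assume "\<nexists>n. \<not> (AE e in ?P. \<not> ?tail n e < ennreal (\<delta> / 2))"
    then have "AE e in ?P. \<forall>n. \<not> ?tail n e < ennreal (\<delta> / 2)"
      by (subst AE_all_countable) blast
    moreover have "AE e in ?P. \<exists>n. ?tail n e < ennreal (\<delta> / 2)"
      using \<delta> by (intro AE_exp1_series_tail_small[OF w(1) _ fin]) auto
    ultimately have "AE e in ?P. False"
      by eventually_elim blast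
    then show False by simp
  qed
  then obtain n where n: "\<not> (AE e in ?P. \<not> ?tail n e < ennreal (\<delta> / 2))" ..
  \<comment> \<open>With n head terms below c, the head is at most n \<delta> / (2 (n + 1)) \<le>
    \<delta> / 2; \<open>Suc n\<close> avoids a zero denominator when n = 0.\<close>
  define c where "c = \<delta> / (2 * real (Suc n))"
  have c: "c > 0" using \<delta> by (simp add: c_def)
  define H where "H = {x \<in> space (PiM {1..n} (\<lambda>_. exp1)). \<forall>i\<in>{1..n}. x i < c}"
  define T where "T = {x \<in> space (PiM {n<..} (\<lambda>_. exp1)). ?tail n x < ennreal (\<delta> / 2)}"
  have H: "H \<in> sets (PiM {1..n} (\<lambda>_. exp1))"
    unfolding H_def by measurable
  have T: "T \<in> sets (PiM {n<..} (\<lambda>_. exp1))"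
    unfolding T_def by measurable
  \<comment> \<open>The term with index i uses coordinate \<open>Suc i\<close>: the head reads
    coordinates 1 to n, the tail only those above n.\<close>
  have "indep_var (PiM {1..n} (\<lambda>_. exp1)) (\<lambda>e. restrict e {1..n})
      (PiM {n<..} (\<lambda>_. exp1)) (\<lambda>e. restrict e {n<..})"
    by (rule indep_var_restrict[OF indep_vars_PiM_coordinates]) auto
  from indep_varD[OF this H T]
  have prod: "prob ((\<lambda>e. (restrict e {1..n}, restrict e {n<..})) -` (H \<times> T) \<inter> space ?P)
    = prob ((\<lambda>e. restrict e {1..n}) -` H \<inter> space ?P) * prob ((\<lambda>e. restrict e {n<..}) -` T \<inter> space ?P)" .
  have "(\<lambda>e. restrict e {1..n}) -` H \<inter> space ?P = {e \<in> space ?P. \<forall>i\<in>{1..n}. e i \<in> {..<c}}"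
    by (auto simp: H_def space_PiM)
  then have "emeasure ?P ((\<lambda>e. restrict e {1..n}) -` H \<inter> space ?P) = (\<Prod>i\<in>{1..n}. emeasure exp1 {..<c})"
    by (simp only: ) (intro emeasure_PiM_Collect, auto)
  then have "emeasure ?P ((\<lambda>e. restrict e {1..n}) -` H \<inter> space ?P) = ennreal (measure exp1 {..<c} ^ n)"
    by (simp add: M.emeasure_eq_measure ennreal_power)
  then have "prob ((\<lambda>e. restrict e {1..n}) -` H \<inter> space ?P) = measure exp1 {..<c} ^ n"
    by (rule measure_eq_emeasure_eq_ennreal[rotated]) simp
  then have posH: "prob ((\<lambda>e. restrict e {1..n}) -` H \<inter> space ?P) > 0"
    using measure_exp1_lessThan_pos[OF c] by simp
  have Teq: "(\<lambda>e. restrict e {n<..}) -` T \<inter> space ?P = {e \<in> space ?P. ?tail n e < ennreal (\<delta> / 2)}"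
    by (auto simp: T_def space_PiM)
  have posT: "prob ((\<lambda>e. restrict e {n<..}) -` T \<inter> space ?P) > 0"
  proof (rule ccontr)
    assume "\<not> 0 < prob ((\<lambda>e. restrict e {n<..}) -` T \<inter> space ?P)"
    then have "prob {e \<in> space ?P. ?tail n e < ennreal (\<delta> / 2)} = 0"
      unfolding Teq by (simp add: zero_less_measure_iff)
    then have "AE e in ?P. \<not> ?tail n e < ennreal (\<delta> / 2)"
      by (subst AE_iff_measurable[OF _ refl]) (auto simp: emeasure_eq_measure)
    with n show False ..
  qed
  have "(\<Sum>i. ennreal (e (Suc i) * w i)) < ennreal \<delta>"
    if e: "\<forall>i\<in>{1..n}. e i < c" "?tail n e < ennreal (\<delta> / 2)" for e
  proof -
    have le: "ennreal (e (Suc i) * w i) \<le> ennreal c" if "i < n" for i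
    \<comment> \<open>The bound is claimed for every e, also outside the almost sure event; a
      negative term becomes 0 under \<open>ennreal\<close>.\<close>
    proof (cases "e (Suc i) \<ge> 0")
      case True
      then have "e (Suc i) * w i \<le> e (Suc i) * 1" using w by (intro mult_left_mono)
      also have "\<dots> \<le> c" using e(1) that by (force simp: less_imp_le)
      finally show ?thesis by (rule ennreal_leI)
    next
      case False
      then show ?thesis using w by (simp add: mult_nonpos_nonneg ennreal_neg)
    qed
    have "(\<Sum>i<n. ennreal (e (Suc i) * w i)) \<le> (\<Sum>i<n. ennreal c)"
      using le by (intro sum_mono) auto
    also have "\<dots> = ennreal (real n * c)"
      using c by (simp add: ennreal_mult ennreal_of_nat_eq_real_of_nat)
    also have "\<dots> \<le> ennreal (\<delta> / 2)"
      using \<delta> by (intro ennreal_leI) (simp add: c_def field_simps)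
    finally have "?tail n e + (\<Sum>i<n. ennreal (e (Suc i) * w i)) \<le> ?tail n e + ennreal (\<delta> / 2)"
      by (rule add_left_mono)
    \<comment> \<open>Strictness comes from the tail alone, the head being bounded only
      weakly.\<close>
    also have "\<dots> < ennreal (\<delta> / 2) + ennreal (\<delta> / 2)"
      using e(2) by (subst add.commute[of "?tail n e"]) (simp add: ennreal_add_left_cancel_less)
    finally have "(\<Sum>i. ennreal (e (Suc i) * w i)) < ennreal (\<delta> / 2) + ennreal (\<delta> / 2)"
      by (subst suminf_offset[of _ n]) auto
    then show ?thesis using \<delta> by (simp flip: ennreal_plus)
  qed
  then have small: "(\<Sum>i. ennreal (e (Suc i) * w i)) < ennreal \<delta>"
    if "(restrict e {1..n}, restrict e {n<..}) \<in> H \<times> T" for e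
    using that by (simp add: H_def T_def)
  define X where "X = (\<lambda>e. (restrict e {1..n}, restrict e {n<..})) -` (H \<times> T) \<inter> space ?P"
  have "AE e in ?P. e \<notin> X"
    using null by eventually_elim (use small in \<open>auto simp: X_def\<close>)
  moreover have "{e \<in> space ?P. e \<in> X} = X"
    by (auto simp: X_def)
  ultimately have "prob X = 0"
    using prob_eq_0_AE[of "\<lambda>e. e \<in> X"] by simp
  then have "prob ((\<lambda>e. (restrict e {1..n}, restrict e {n<..})) -` (H \<times> T) \<inter> space ?P) = 0"
    by (simp only: X_def)
  with prod mult_pos_pos[OF posH posT] show False by linarith
qed

section \<open>Positivity of V and its mass near zero\<close>

text \<open>Collects the dependence on the degrees, so that for fixed \<open>d\<close> the series is
  a linear combination of exponentials with constant coefficients.\<close>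

definition V_weight :: "(nat \<Rightarrow> nat) \<Rightarrow> nat \<Rightarrow> real" where
  "V_weight d i = inverse (1 + (\<Sum>j=1..Suc i. (real (d j) - 2)))"

lemma V_series_eq_weight: "V_series e d = (\<Sum>i. ennreal (e (Suc i) * V_weight d i))"
  by (simp add: V_series_def V_weight_def divide_inverse)

text \<open>Degrees at least 2 make all increments of the denominators nonnegative, so each
  denominator is at least 1.\<close>

lemma V_weight_bounds:
  assumes "\<forall>j\<ge>1. 2 \<le> d j"
  shows "0 < V_weight d i" "V_weight d i \<le> 1"
proof -
  have "0 \<le> (\<Sum>j=1..Suc i. (real (d j) - 2))"
    using assms by (intro sum_nonneg) (auto simp: of_nat_le_iff[of 2, simplified])
  then show "0 < V_weight d i" "V_weight d i \<le> 1"
    by (auto simp: V_weight_def inverse_le_1_iff)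
qed

lemma measurable_V_series [measurable]:
  "(\<lambda>(e, d). V_series e d) \<in> borel_measurable
     (PiM {1..} (\<lambda>_. exp1) \<Otimes>\<^sub>M PiM {1..} (\<lambda>_. size_biased \<mu>))"
  unfolding V_series_def by measurable

lemma sets_Collect_V_series:
  assumes "{v. P v} \<in> sets borel"
  shows "{x \<in> space (PiM {1..} (\<lambda>_. exp1) \<Otimes>\<^sub>M PiM {1..} (\<lambda>_. size_biased \<mu>)).
      P (V_series (fst x) (snd x))}
    \<in> sets (PiM {1..} (\<lambda>_. exp1) \<Otimes>\<^sub>M PiM {1..} (\<lambda>_. size_biased \<mu>))"
  using measurable_sets[OF measurable_V_series assms, of \<mu>]
  by (simp add: vimage_def Int_def conj_commute split_beta')

lemma AE_V_law_iff:
  assumes "{v. P v} \<in> sets borel"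
  shows "(AE v in V_law \<mu>. P v) \<longleftrightarrow>
    (AE x in PiM {1..} (\<lambda>_. exp1) \<Otimes>\<^sub>M PiM {1..} (\<lambda>_. size_biased \<mu>). P (V_series (fst x) (snd x)))"
  unfolding V_law_def
  by (subst AE_distr_iff) (use assms in \<open>auto intro: measurable_V_series simp: split_beta'\<close>)

lemma sets_V_law [simp, measurable_cong]: "sets (V_law \<mu>) = sets borel"
  and space_V_law [simp]: "space (V_law \<mu>) = UNIV"
  by (simp_all add: V_law_def)

locale degree_law = prob_space \<mu> for \<mu> :: "nat measure" +
  assumes sets_eq: "sets \<mu> = UNIV"
    and ge_2: "AE k in \<mu>. 2 \<le> k"
    and integrable: "integrable \<mu> real"
begin

lemma mean_pos: "0 < (\<integral>n. real n \<partial>\<mu>)"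
proof -
  have "2 \<le> (\<integral>n. real n \<partial>\<mu>)"
    using integrable ge_2 by (intro integral_ge_const) (auto elim!: eventually_mono)
  then show ?thesis by simp
qed

sublocale size_biased: prob_space "size_biased \<mu>"
  using finite_measure_axioms sets_eq integrable mean_pos by (rule prob_space_size_biased)

sublocale times: prob_space "PiM {1::nat..} (\<lambda>_. exp1)"
  by (intro prob_space_PiM prob_space_exp1)

sublocale degrees: prob_space "PiM {1::nat..} (\<lambda>_. size_biased \<mu>)"
  by (intro prob_space_PiM size_biased.prob_space_axioms)

sublocale sequences: pair_prob_space "PiM {1::nat..} (\<lambda>_. exp1)" "PiM {1::nat..} (\<lambda>_. size_biased \<mu>)" ..

lemma AE_degrees_ge_2: "AE d in PiM {1::nat..} (\<lambda>_. size_biased \<mu>). \<forall>j\<ge>1. 2 \<le> d j"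
proof -
  have "AE d in PiM {1::nat..} (\<lambda>_. size_biased \<mu>). \<forall>j\<in>{1..}. 2 \<le> d j"
    by (subst AE_ball_countable)
       (auto intro!: AE_PiM_component AE_size_biased size_biased.prob_space_axioms
          finite_measure_axioms sets_eq ge_2)
  then show ?thesis unfolding Ball_def atLeast_iff .
qed

lemma prob_space_V_law: "prob_space (V_law \<mu>)"
  unfolding V_law_def by (intro sequences.prob_space_distr) measurable

lemma AE_V_law_pos: "AE v in V_law \<mu>. 0 < v"
proof (subst AE_V_law_iff)
  have "AE e in PiM {1::nat..} (\<lambda>_. exp1). 0 < e 1"
    by (intro AE_PiM_component AE_exp1_pos prob_space_exp1) auto
  then have "AE e in PiM {1::nat..} (\<lambda>_. exp1).
      AE d in PiM {1::nat..} (\<lambda>_. size_biased \<mu>). 0 < V_series e d"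
  proof eventually_elim
    case (elim e)
    from AE_degrees_ge_2 show ?case
    proof eventually_elim
      case d: (elim d)
      have "0 < ennreal (e (Suc 0) * V_weight d 0)"
        using elim V_weight_bounds[OF d] by (simp add: One_nat_def)
      also have "\<dots> \<le> V_series e d"
        unfolding V_series_eq_weight
        using sum_le_suminf[of "\<lambda>i. ennreal (e (Suc i) * V_weight d i)" "{0}"] by simp
      finally show ?case .
    qed
  qed
  then show "AE x in PiM {1..} (\<lambda>_. exp1) \<Otimes>\<^sub>M PiM {1..} (\<lambda>_. size_biased \<mu>).
      0 < V_series (fst x) (snd x)"
    by (intro sequences.AE_pair_measure sets_Collect_V_series) simp_all
qed simp

text \<open>If the interval had mass 0, Fubini would give, for almost every frozen degree sequence,
  a weighted exponential series that is almost surely finite and almost surely not below \<delta>.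
  This contradicts \<open>exp1_series_small_not_null\<close>.\<close>

lemma measure_V_law_lessThan_pos:
  assumes fin: "AE v in V_law \<mu>. v < \<infinity>" and \<delta>: "0 < \<delta>"
  shows "0 < measure (V_law \<mu>) {..<ennreal \<delta>}"
proof (rule ccontr)
  interpret V: prob_space "V_law \<mu>" by (rule prob_space_V_law)
  assume "\<not> 0 < measure (V_law \<mu>) {..<ennreal \<delta>}"
  then have "measure (V_law \<mu>) {..<ennreal \<delta>} = 0"
    by (simp add: zero_less_measure_iff)
  then have "AE v in V_law \<mu>. \<not> v < ennreal \<delta>"
    by (subst AE_iff_measurable[OF _ refl]) (auto simp: V.emeasure_eq_measure lessThan_def)
  \<comment> \<open>Finiteness is carried along, since it is needed for the series with frozen
    degrees.\<close>
  with fin have "AE v in V_law \<mu>. v < \<infinity> \<and> \<not> v < ennreal \<delta>"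
    by eventually_elim auto
  then have "AE x in PiM {1..} (\<lambda>_. exp1) \<Otimes>\<^sub>M PiM {1..} (\<lambda>_. size_biased \<mu>).
      V_series (fst x) (snd x) < \<infinity> \<and> \<not> V_series (fst x) (snd x) < ennreal \<delta>"
    by (subst (asm) AE_V_law_iff) measurable
  \<comment> \<open>The degrees move to the outer quantifier, so that they can be frozen.\<close>
  then have "AE d in PiM {1..} (\<lambda>_. size_biased \<mu>). AE e in PiM {1..} (\<lambda>_. exp1).
      V_series e d < \<infinity> \<and> \<not> V_series e d < ennreal \<delta>"
    by (subst sequences.AE_commute[symmetric], intro sets_Collect_V_series)
       (measurable, auto dest: sequences.AE_pair)
  with AE_degrees_ge_2 have "AE d in PiM {1::nat..} (\<lambda>_. size_biased \<mu>). False"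
  proof eventually_elim
    case (elim d)
    have "\<not> (AE e in PiM {1..} (\<lambda>_. exp1).
        \<not> (\<Sum>i. ennreal (e (Suc i) * V_weight d i)) < ennreal \<delta>)"
      using elim(2) \<delta> V_weight_bounds[OF elim(1)]
      by (intro exp1_series_small_not_null)
        (auto simp: V_series_eq_weight eventually_conj_iff intro: less_imp_le)
    with elim(2) show ?case
      by (simp add: V_series_eq_weight eventually_conj_iff)
  qed
  then show False by simp
qed

end

section \<open>Concentration of the degree in the shortest path tree\<close>

text \<open>The indicators are i.i.d. with values in [0,1], so the sum of squared ranges in
  Hoeffding's inequality is k.\<close>

lemma (in prob_space)
  assumes indep: "indep_vars (\<lambda>_. N) Z {1::nat..}"
    and law: "\<And>i. 1 \<le> i \<Longrightarrow> distr M N (Z i) = distr M N (Z 1)"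
    and A: "A \<in> sets N" and k: "1 \<le> k" and \<epsilon>: "0 \<le> \<epsilon>"
  shows Hoeffding_count_ge: "prob {\<omega> \<in> space M. real k * prob {\<omega> \<in> space M. Z 1 \<omega> \<in> A} + \<epsilon>
      \<le> (\<Sum>i=1..k. indicator A (Z i \<omega>))} \<le> exp (- 2 * \<epsilon>\<^sup>2 / real k)" (is ?ge)
    and Hoeffding_count_le: "prob {\<omega> \<in> space M. (\<Sum>i=1..k. indicator A (Z i \<omega>))
      \<le> real k * prob {\<omega> \<in> space M. Z 1 \<omega> \<in> A} - \<epsilon>} \<le> exp (- 2 * \<epsilon>\<^sup>2 / real k)" (is ?le)
proof -
  have Z [measurable]: "Z i \<in> measurable M N" if "1 \<le> i" for i
    using indep that by (auto simp: indep_vars_def)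
  have [measurable]: "A \<in> sets N" by (rule A)
  interpret Hoeffding_ineq_iid M "{1..k}" "\<lambda>i \<omega>. indicator A (Z i \<omega>)" "\<lambda>\<omega>. indicator A (Z 1 \<omega>)" 0 1
    "expectation (\<lambda>\<omega>. indicator A (Z 1 \<omega>))"
  proof unfold_locales
    show "indep_vars (\<lambda>_. borel) (\<lambda>i \<omega>. indicator A (Z i \<omega>)) {1..k}"
      by (rule indep_vars_compose2[OF indep_vars_subset[OF indep]]) auto
    fix i assume i: "i \<in> {1..k}"
    have distr_indicator: "distr M borel (\<lambda>\<omega>. indicator A (Z i \<omega>) :: real)
        = distr (distr M N (Z i)) borel (indicator A)" if "1 \<le> i" for i
      using that by (subst distr_distr) (auto simp: comp_def)
    show "distr M borel (\<lambda>\<omega>. indicator A (Z i \<omega>)) = distr M borel (\<lambda>\<omega>. indicator A (Z 1 \<omega>) :: real)"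
      using i distr_indicator[of i] distr_indicator[of 1] law[of i] by simp
  qed (auto split: split_indicator)
  have "expectation (\<lambda>\<omega>. indicator A (Z 1 \<omega>)) = expectation (indicator {\<omega> \<in> space M. Z 1 \<omega> \<in> A})"
    by (intro Bochner_Integration.integral_cong) (auto simp: indicator_def)
  also have "\<dots> = prob {\<omega> \<in> space M. Z 1 \<omega> \<in> A}"
    using Z[of 1] by (subst Bochner_Integration.integral_indicator) auto
  finally have p: "expectation (\<lambda>\<omega>. indicator A (Z 1 \<omega>)) = prob {\<omega> \<in> space M. Z 1 \<omega> \<in> A}" .
  show ?ge ?le
    using Hoeffding_ineq_ge[OF \<epsilon>] Hoeffding_ineq_le[OF \<epsilon>] k by (simp_all add: p)
qed

section \<open>Deterministic bounds on the degree\<close>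

lemma measurable_spt_degree:
  assumes [measurable]: "\<And>i. 1 \<le> i \<Longrightarrow> v i \<in> borel_measurable N" "\<And>i. 1 \<le> i \<Longrightarrow> e i \<in> borel_measurable N"
  shows "(\<lambda>x. spt_degree n (\<lambda>i. v i x) (\<lambda>i. e i x)) \<in> measurable N (count_space UNIV)"
proof -
  have [measurable]: "(\<lambda>x. hitting_time n (\<lambda>i. v i x) (\<lambda>i. e i x)) \<in> borel_measurable N"
    unfolding hitting_time_def by (intro borel_measurable_Min) auto
  have "(\<lambda>x. of_bool (hitting_time n (\<lambda>i. v i x) (\<lambda>i. e i x) < v i x - e i x) :: nat)
      \<in> measurable N (count_space UNIV)" if "i \<in> {1..n}" for i
  proof -
    have [measurable]: "v i \<in> borel_measurable N" "e i \<in> borel_measurable N"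
      using that assms by auto
    show ?thesis by measurable
  qed
  then show ?thesis
    unfolding spt_degree_def by measurable
qed

text \<open>Makes the degree insensitive to restricting the families to their index sets, as the
  independence argument does.\<close>

lemma spt_degree_cong:
  assumes "\<And>i. 1 \<le> i \<Longrightarrow> i \<le> n \<Longrightarrow> v i = v' i \<and> e i = e' i"
  shows "spt_degree n v e = spt_degree n v' e'"
proof -
  have "hitting_time n v e = hitting_time n v' e'"
    unfolding hitting_time_def using assms by (intro arg_cong[where f = Min] image_cong) auto
  then show ?thesis
    unfolding spt_degree_def using assms by (intro arg_cong2[where f = "(+)"] sum.cong) auto
qed

text \<open>With 1 \<le> n the minimum is attained, hence positive, and v - e > \<xi> > 0 forces e <
  v.\<close>

lemma spt_degree_le:
  assumes "1 \<le> n" "\<And>i. 1 \<le> i \<Longrightarrow> i \<le> n \<Longrightarrow> 0 < v i \<and> 0 < e i"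
  shows "real (spt_degree n v e) \<le> 1 + (\<Sum>i=1..n. indicator {(v, e). e < v} (v i, e i))"
proof -
  have "hitting_time n v e \<in> (\<lambda>i. v i + e i) ` {1..n}"
    unfolding hitting_time_def using assms by (intro Min_in) auto
  then have "0 < hitting_time n v e"
    using assms by force
  then have "(\<Sum>i=1..n. real (of_bool (v i - e i > hitting_time n v e)))
      \<le> (\<Sum>i=1..n. indicator {(v, e). e < v} (v i, e i))"
    by (intro sum_mono) (auto simp: indicator_def)
  then show ?thesis by (simp add: spt_degree_def)
qed

text \<open>A single index with v + e < \<delta> pushes the minimum below \<delta>.\<close>

lemma spt_degree_ge:
  assumes "i \<in> {1..n}" "v i + e i < \<delta>"
  shows "(\<Sum>i=1..n. indicator {(v, e). \<delta> < v - e} (v i, e i)) \<le> real (spt_degree n v e)"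
proof -
  have "hitting_time n v e \<le> v i + e i"
    unfolding hitting_time_def using assms by (intro Min_le) auto
  then have "(\<Sum>i=1..n. indicator {(v, e). \<delta> < v - e} (v i, e i))
      \<le> (\<Sum>i=1..n. real (of_bool (v i - e i > hitting_time n v e)))"
    using assms by (intro sum_mono) (auto simp: indicator_def)
  then show ?thesis by (simp add: spt_degree_def)
qed

section \<open>Independence of the degree and the marks\<close>

text \<open>Of the law of V only three features enter the concentration argument: it is common to
  all indices, positive, and charges every neighbourhood of 0.\<close>

locale marked_degree = prob_space M for M :: "'a measure" +
  fixes D :: "'a \<Rightarrow> nat" and V E :: "nat \<Rightarrow> 'a \<Rightarrow> real"
  assumes D_measurable [measurable]: "D \<in> measurable M (count_space UNIV)"
    and indep: "indep_vars (\<lambda>_. borel)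
           (case_sum (\<lambda>_::unit. \<lambda>\<omega>. real (D \<omega>)) (case_sum V E))
           ({()} <+> {1..} <+> {1..})"
    and V_law: "\<And>i. 1 \<le> i \<Longrightarrow> distr M borel (V i) = distr M borel (V 1)"
    and E_law: "\<And>i. 1 \<le> i \<Longrightarrow> distr M borel (E i) = exp1"
    and V_pos: "AE \<omega> in M. 0 < V 1 \<omega>"
    and V_small: "\<And>\<delta>. 0 < \<delta> \<Longrightarrow> 0 < prob {\<omega> \<in> space M. V 1 \<omega> < \<delta>}"
begin

lemma V_measurable [measurable]: "1 \<le> i \<Longrightarrow> V i \<in> borel_measurable M"
  and E_measurable [measurable]: "1 \<le> i \<Longrightarrow> E i \<in> borel_measurable M"
  using indep by (force simp: indep_vars_def)+

abbreviation mark :: "nat \<Rightarrow> 'a \<Rightarrow> real \<times> real" where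
  "mark i \<omega> \<equiv> (V i \<omega>, E i \<omega>)"

lemma AE_pos: "AE \<omega> in M. \<forall>i\<ge>1. 0 < V i \<omega> \<and> 0 < E i \<omega>"
proof -
  have "AE \<omega> in M. 0 < V i \<omega> \<and> 0 < E i \<omega>" if i: "1 \<le> i" for i
  proof (rule AE_conjI)
    have "AE v in distr M borel (V 1). 0 < v"
      using V_pos by (subst AE_distr_iff) auto
    then have "AE v in distr M borel (V i). 0 < v" by (simp only: V_law[OF i])
    then show "AE \<omega> in M. 0 < V i \<omega>" using i by (subst (asm) AE_distr_iff) auto
    have "AE e in distr M borel (E i). 0 < e"
      by (simp only: E_law[OF i] AE_exp1_pos)
    then show "AE \<omega> in M. 0 < E i \<omega>" using i by (subst (asm) AE_distr_iff) auto
  qed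
  then have "AE \<omega> in M. \<forall>i\<in>{1..}. 0 < V i \<omega> \<and> 0 < E i \<omega>"
    by (subst AE_ball_countable) auto
  then show ?thesis unfolding Ball_def atLeast_iff .
qed

text \<open>Independence passes to disjoint blocks of indices; block j holds the positions of V j
  and E j in the sum type.\<close>

lemma indep_marks: "indep_vars (\<lambda>_. borel \<Otimes>\<^sub>M borel) mark {1..}"
proof -
  let ?X = "case_sum (\<lambda>_::unit. \<lambda>\<omega>. real (D \<omega>)) (case_sum V E)"
  let ?K = "\<lambda>j. {Inr (Inl j), Inr (Inr j)} :: (unit + nat + nat) set"
  have "indep_vars (\<lambda>j. PiM (?K j) (\<lambda>_. borel)) (\<lambda>j \<omega>. restrict (\<lambda>i. ?X i \<omega>) (?K j)) {1..}"
    by (rule indep_vars_restrict[OF indep]) (auto simp: disjoint_family_on_def)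
  then have "indep_vars (\<lambda>_. borel \<Otimes>\<^sub>M borel)
      (\<lambda>j \<omega>. (\<lambda>x. (x (Inr (Inl j)), x (Inr (Inr j)))) (restrict (\<lambda>i. ?X i \<omega>) (?K j))) {1..}"
    by (rule indep_vars_compose2) measurable
  then show ?thesis by simp
qed

lemma indep_mark:
  assumes "1 \<le> i"
  shows "indep_var borel (V i) borel (E i)"
proof -
  let ?X = "case_sum (\<lambda>_::unit. \<lambda>\<omega>. real (D \<omega>)) (case_sum V E)"
  have "indep_var (PiM {Inr (Inl i)} (\<lambda>_. borel)) (\<lambda>\<omega>. restrict (\<lambda>i. ?X i \<omega>) {Inr (Inl i)})
      (PiM {Inr (Inr i)} (\<lambda>_. borel)) (\<lambda>\<omega>. restrict (\<lambda>i. ?X i \<omega>) {Inr (Inr i)})"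
    using assms by (intro indep_var_restrict[OF indep]) auto
  then have "indep_var borel ((\<lambda>x. x (Inr (Inl i))) \<circ> (\<lambda>\<omega>. restrict (\<lambda>i. ?X i \<omega>) {Inr (Inl i)}))
      borel ((\<lambda>x. x (Inr (Inr i))) \<circ> (\<lambda>\<omega>. restrict (\<lambda>i. ?X i \<omega>) {Inr (Inr i)}))"
    by (rule indep_var_compose) measurable
  then show ?thesis by (simp add: comp_def)
qed

lemma mark_law:
  assumes "1 \<le> i"
  shows "distr M (borel \<Otimes>\<^sub>M borel) (mark i) = distr M (borel \<Otimes>\<^sub>M borel) (mark 1)"
proof -
  have "distr M (borel \<Otimes>\<^sub>M borel) (mark i) = distr M borel (V 1) \<Otimes>\<^sub>M exp1" if "1 \<le> i" for i
    using indep_mark[OF that] that by (simp add: indep_var_distribution_eq V_law[OF that] E_law)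
  then show ?thesis using assms by simp
qed

text \<open>The degree with \<open>D\<close> frozen at k. It depends on the marks alone, while the
  variable of the theorem is the diagonal \<open>tree_degree (D \<omega>) \<omega>\<close>.\<close>

definition tree_degree :: "nat \<Rightarrow> 'a \<Rightarrow> nat" where
  "tree_degree k \<omega> = spt_degree k (\<lambda>i. V i \<omega>) (\<lambda>i. E i \<omega>)"

lemma tree_degree_measurable [measurable]: "tree_degree k \<in> measurable M (count_space UNIV)"
  unfolding tree_degree_def[abs_def] by (rule measurable_spt_degree) auto

lemma tree_degree_D_measurable [measurable]:
  "(\<lambda>\<omega>. tree_degree (D \<omega>) \<omega>) \<in> measurable M (count_space UNIV)"
  by (rule measurable_compose_countable[OF tree_degree_measurable D_measurable])

lemma indep_degree_tree_degree:
  "prob {\<omega> \<in> space M. D \<omega> = k \<and> tree_degree k \<omega> \<in> S}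
    = prob {\<omega> \<in> space M. D \<omega> = k} * prob {\<omega> \<in> space M. tree_degree k \<omega> \<in> S}"
proof -
  let ?X = "case_sum (\<lambda>_::unit. \<lambda>\<omega>. real (D \<omega>)) (case_sum V E)"
  let ?B = "Inr ` ({1..} <+> {1..}) :: (unit + nat + nat) set"
  let ?f = "\<lambda>x :: unit + nat + nat \<Rightarrow> real.
    real (spt_degree k (\<lambda>i. x (Inr (Inl i))) (\<lambda>i. x (Inr (Inr i))))"
  have ind: "indep_var (PiM {Inl ()} (\<lambda>_. borel)) (\<lambda>\<omega>. restrict (\<lambda>i. ?X i \<omega>) {Inl ()})
      (PiM ?B (\<lambda>_. borel)) (\<lambda>\<omega>. restrict (\<lambda>i. ?X i \<omega>) ?B)"
    by (intro indep_var_restrict[OF indep]) auto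
  have f: "?f \<in> measurable (PiM ?B (\<lambda>_. borel)) borel"
    by (intro measurable_compose[OF measurable_spt_degree]) (auto intro!: measurable_component_singleton)
  have "indep_var borel ((\<lambda>x. x (Inl ())) \<circ> (\<lambda>\<omega>. restrict (\<lambda>i. ?X i \<omega>) {Inl ()}))
      borel (?f \<circ> (\<lambda>\<omega>. restrict (\<lambda>i. ?X i \<omega>) ?B))"
    by (rule indep_var_compose[OF ind _ f]) measurable
  \<comment> \<open>Restriction to \<open>?B\<close> leaves the entries 1 to k unchanged, and no
    others are read.\<close>
  moreover have "?f (restrict (\<lambda>i. ?X i \<omega>) ?B) = real (tree_degree k \<omega>)" for \<omega>
    unfolding tree_degree_def of_nat_eq_iff by (rule spt_degree_cong) auto
  ultimately have "indep_var borel (\<lambda>\<omega>. real (D \<omega>)) borel (\<lambda>\<omega>. real (tree_degree k \<omega>))"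
    by (simp add: comp_def)
  moreover have "real ` S \<in> sets borel"
    by (rule sets.countable) auto
  ultimately show ?thesis
    using indep_varD[of borel "\<lambda>\<omega>. real (D \<omega>)" borel "\<lambda>\<omega>. real (tree_degree k \<omega>)" "{real k}" "real ` S"]
    by (simp add: vimage_def Int_def conj_commute conj_left_commute inj_image_mem_iff)
qed

definition contact_prob :: real where
  "contact_prob = prob {\<omega> \<in> space M. E 1 \<omega> < V 1 \<omega>}"

lemma prob_V_E:
  assumes [measurable]: "A \<in> sets borel" "B \<in> sets borel"
  shows "prob {\<omega> \<in> space M. V 1 \<omega> \<in> A \<and> E 1 \<omega> \<in> B} = prob {\<omega> \<in> space M. V 1 \<omega> \<in> A} * measure exp1 B"
proof -
  have "measure exp1 B = measure (distr M borel (E 1)) B"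
    by (simp only: E_law[OF order_refl])
  also have "\<dots> = prob {\<omega> \<in> space M. E 1 \<omega> \<in> B}"
    by (subst measure_distr) (auto simp: vimage_def Int_def conj_commute)
  finally show ?thesis
    using indep_varD[OF indep_mark[OF order_refl] assms]
    by (simp add: vimage_def Int_def conj_commute conj_left_commute)
qed

text \<open>For every c > 0 the product P(V > c) P(E < c) is at most the contact probability. If
  that were 0, then V \<le> c almost surely along a sequence of c tending to 0, against V >
  0.\<close>

lemma contact_prob_pos: "0 < contact_prob"
proof (rule ccontr)
  assume "\<not> 0 < contact_prob"
  then have p: "contact_prob = 0" by (simp add: contact_prob_def zero_less_measure_iff)
  have "AE \<omega> in M. \<not> inverse (real (Suc n)) < V 1 \<omega>" for n
  proof -
    let ?c = "inverse (real (Suc n))"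
    have "prob {\<omega> \<in> space M. V 1 \<omega> \<in> {?c<..}} * measure exp1 {..<?c}
        = prob {\<omega> \<in> space M. V 1 \<omega> \<in> {?c<..} \<and> E 1 \<omega> \<in> {..<?c}}"
      by (rule prob_V_E[symmetric]) auto
    also have "\<dots> \<le> contact_prob"
      unfolding contact_prob_def by (intro finite_measure_mono) auto
    finally have "prob {\<omega> \<in> space M. V 1 \<omega> \<in> {?c<..}} * measure exp1 {..<?c} \<le> 0"
      using p by simp
    then have "prob {\<omega> \<in> space M. V 1 \<omega> \<in> {?c<..}} = 0"
      using measure_exp1_lessThan_pos[of ?c] measure_nonneg[of M]
      by (auto simp: mult_le_0_iff not_less intro: antisym)
    then show ?thesis
      by (subst (asm) prob_eq_0) auto
  qed
  then have "AE \<omega> in M. \<forall>n. \<not> inverse (real (Suc n)) < V 1 \<omega>"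
    by (subst AE_all_countable) blast
  with V_pos have "AE \<omega> in M. False"
    by eventually_elim (use reals_Archimedean in blast)
  then show False by simp
qed

section \<open>Counts of marks and concentration for fixed degree\<close>

definition mark_count :: "(real \<times> real) set \<Rightarrow> nat \<Rightarrow> 'a \<Rightarrow> real" where
  "mark_count A k \<omega> = (\<Sum>i=1..k. indicator A (mark i \<omega>))"

lemma mark_count_measurable [measurable]:
  assumes [measurable]: "A \<in> sets (borel \<Otimes>\<^sub>M borel)"
  shows "mark_count A k \<in> borel_measurable M"
  unfolding mark_count_def[abs_def]
proof (intro borel_measurable_sum)
  fix i assume "i \<in> {1..k}"
  then have [measurable]: "V i \<in> borel_measurable M" "E i \<in> borel_measurable M" by auto
  show "(\<lambda>\<omega>. indicator A (mark i \<omega>) :: real) \<in> borel_measurable M" by measurable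
qed

lemma sets_mark_events [measurable]:
  "{(v, e). (e::real) < v} \<in> sets (borel \<Otimes>\<^sub>M borel)"
  "{(v, e). (\<delta>::real) < v - e} \<in> sets (borel \<Otimes>\<^sub>M borel)"
  "{(v, e). v + e < (\<delta>::real)} \<in> sets (borel \<Otimes>\<^sub>M borel)"
proof -
  let ?N = "borel \<Otimes>\<^sub>M borel :: (real \<times> real) measure"
  have "{x \<in> space ?N. snd x < fst x} \<in> sets ?N" "{x \<in> space ?N. \<delta> < fst x - snd x} \<in> sets ?N"
    "{x \<in> space ?N. fst x + snd x < \<delta>} \<in> sets ?N"
    by measurable
  then show "{(v, e). (e::real) < v} \<in> sets ?N" "{(v, e). (\<delta>::real) < v - e} \<in> sets ?N"
    "{(v, e). v + e < (\<delta>::real)} \<in> sets ?N"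
    by (simp_all add: space_pair_measure split_beta')
qed

lemma mark_count_ge:
  assumes "A \<in> sets (borel \<Otimes>\<^sub>M borel)" "1 \<le> k" "0 \<le> \<epsilon>"
  shows "prob {\<omega> \<in> space M. real k * prob {\<omega> \<in> space M. mark 1 \<omega> \<in> A} + \<epsilon> \<le> mark_count A k \<omega>}
    \<le> exp (- 2 * \<epsilon>\<^sup>2 / real k)"
  unfolding mark_count_def using Hoeffding_count_ge[OF indep_marks mark_law assms] .

lemma mark_count_le:
  assumes "A \<in> sets (borel \<Otimes>\<^sub>M borel)" "1 \<le> k" "0 \<le> \<epsilon>"
  shows "prob {\<omega> \<in> space M. mark_count A k \<omega> \<le> real k * prob {\<omega> \<in> space M. mark 1 \<omega> \<in> A} - \<epsilon>}
    \<le> exp (- 2 * \<epsilon>\<^sup>2 / real k)"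
  unfolding mark_count_def using Hoeffding_count_le[OF indep_marks mark_law assms] .

lemma AE_tree_degree_le:
  "AE \<omega> in M. \<forall>k\<ge>1. real (tree_degree k \<omega>) \<le> 1 + mark_count {(v, e). e < v} k \<omega>"
  using AE_pos unfolding tree_degree_def mark_count_def
  by eventually_elim (intro allI impI spt_degree_le, auto)

lemma tree_degree_ge:
  assumes "0 < mark_count {(v, e). v + e < \<delta>} k \<omega>"
  shows "mark_count {(v, e). \<delta> < v - e} k \<omega> \<le> real (tree_degree k \<omega>)"
proof -
  have "\<exists>i\<in>{1..k}. V i \<omega> + E i \<omega> < \<delta>"
  proof (rule ccontr)
    assume "\<not> ?thesis"
    then have "mark_count {(v, e). v + e < \<delta>} k \<omega> = 0"
      unfolding mark_count_def by (intro sum.neutral) auto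
    with assms show False by simp
  qed
  then obtain i where "i \<in> {1..k}" "V i \<omega> + E i \<omega> < \<delta>" ..
  from spt_degree_ge[where v = "\<lambda>i. V i \<omega>" and e = "\<lambda>i. E i \<omega>", OF this] show ?thesis
    by (simp add: tree_degree_def mark_count_def)
qed

text \<open>Continuity from below. It supplies a \<delta> for which demanding V - E > \<delta>
  instead of V > E costs little probability.\<close>

lemma tendsto_prob_gap:
  "(\<lambda>n. prob {\<omega> \<in> space M. inverse (real (Suc n)) < V 1 \<omega> - E 1 \<omega>}) \<longlonglongrightarrow> contact_prob"
proof -
  let ?A = "\<lambda>n. {\<omega> \<in> space M. inverse (real (Suc n)) < V 1 \<omega> - E 1 \<omega>}"
  have "(\<lambda>n. prob (?A n)) \<longlonglongrightarrow> prob (\<Union>n. ?A n)"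
  proof (rule finite_Lim_measure_incseq)
    show "incseq ?A"
    proof (rule incseq_SucI, safe)
      fix n \<omega> assume "inverse (real (Suc n)) < V 1 \<omega> - E 1 \<omega>"
      moreover have "inverse (real (Suc (Suc n))) \<le> inverse (real (Suc n))"
        by (intro le_imp_inverse_le) auto
      ultimately show "inverse (real (Suc (Suc n))) < V 1 \<omega> - E 1 \<omega>" by linarith
    qed
  qed auto
  also have "(\<Union>n. ?A n) = {\<omega> \<in> space M. E 1 \<omega> < V 1 \<omega>}"
  proof (intro equalityI subsetI)
    fix \<omega> assume "\<omega> \<in> {\<omega> \<in> space M. E 1 \<omega> < V 1 \<omega>}"
    then show "\<omega> \<in> (\<Union>n. ?A n)"
      using reals_Archimedean[of "V 1 \<omega> - E 1 \<omega>"] by auto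
  next
    fix \<omega> assume "\<omega> \<in> (\<Union>n. ?A n)"
    then obtain n where "\<omega> \<in> space M" "inverse (real (Suc n)) < V 1 \<omega> - E 1 \<omega>" by auto
    moreover from this(2) have "0 < V 1 \<omega> - E 1 \<omega>"
      by (rule less_trans[rotated]) simp
    ultimately show "\<omega> \<in> {\<omega> \<in> space M. E 1 \<omega> < V 1 \<omega>}" by simp
  qed
  finally show ?thesis by (simp only: contact_prob_def)
qed

lemma prob_sum_small_pos:
  assumes "0 < \<delta>"
  shows "0 < prob {\<omega> \<in> space M. V 1 \<omega> + E 1 \<omega> < \<delta>}"
proof -
  have "0 < prob {\<omega> \<in> space M. V 1 \<omega> \<in> {..<\<delta> / 2}} * measure exp1 {..<\<delta> / 2}"
    using assms V_small[of "\<delta> / 2"] by (intro mult_pos_pos measure_exp1_lessThan_pos) auto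
  also have "\<dots> = prob {\<omega> \<in> space M. V 1 \<omega> \<in> {..<\<delta> / 2} \<and> E 1 \<omega> \<in> {..<\<delta> / 2}}"
    by (rule prob_V_E[symmetric]) auto
  also have "\<dots> \<le> prob {\<omega> \<in> space M. V 1 \<omega> + E 1 \<omega> < \<delta>}"
    by (intro finite_measure_mono) auto
  finally show ?thesis .
qed

text \<open>Half of \<epsilon> pays for replacing V > E by V - E > \<delta>, the other half is the
  Hoeffding deviation. The event that no mark has V + E < \<delta> is exponentially unlikely as
  well.\<close>

lemma tree_degree_not_small:
  assumes \<epsilon>: "0 < \<epsilon>"
  shows "(\<lambda>k. prob {\<omega> \<in> space M. real (tree_degree k \<omega>) \<le> real k * (contact_prob - \<epsilon>)}) \<longlonglongrightarrow> 0"
proof -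
  have "\<forall>\<^sub>F n in sequentially. contact_prob - \<epsilon> / 2 < prob {\<omega> \<in> space M. inverse (real (Suc n)) < V 1 \<omega> - E 1 \<omega>}"
    using \<epsilon> by (intro order_tendstoD(1)[OF tendsto_prob_gap]) auto
  then obtain n where n: "contact_prob - \<epsilon> / 2 < prob {\<omega> \<in> space M. inverse (real (Suc n)) < V 1 \<omega> - E 1 \<omega>}"
    by (auto simp: eventually_sequentially)
  define \<delta> where "\<delta> = inverse (real (Suc n))"
  define r where "r = prob {\<omega> \<in> space M. V 1 \<omega> + E 1 \<omega> < \<delta>}"
  have r: "r > 0" unfolding r_def by (rule prob_sum_small_pos) (simp add: \<delta>_def)
  let ?A = "{(v, e). \<delta> < v - e}" and ?B = "{(v, e). v + e < \<delta>}"
  have le: "prob {\<omega> \<in> space M. real (tree_degree k \<omega>) \<le> real k * (contact_prob - \<epsilon>)}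
      \<le> exp (- (\<epsilon>\<^sup>2 / 2) * real k) + exp (- (2 * r\<^sup>2) * real k)" if k: "1 \<le> k" for k
  proof -
    let ?X = "{\<omega> \<in> space M. mark_count ?A k \<omega> \<le> real k * prob {\<omega> \<in> space M. mark 1 \<omega> \<in> ?A} - real k * (\<epsilon> / 2)}"
    \<comment> \<open>The deviation k r equals the full mean, so this event says that the count is
      at most 0.\<close>
    let ?Y = "{\<omega> \<in> space M. mark_count ?B k \<omega> \<le> real k * prob {\<omega> \<in> space M. mark 1 \<omega> \<in> ?B} - real k * r}"
    have sub: "{\<omega> \<in> space M. real (tree_degree k \<omega>) \<le> real k * (contact_prob - \<epsilon>)} \<subseteq> ?X \<union> ?Y"
    proof
      fix \<omega> assume \<omega>: "\<omega> \<in> {\<omega> \<in> space M. real (tree_degree k \<omega>) \<le> real k * (contact_prob - \<epsilon>)}"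
      show "\<omega> \<in> ?X \<union> ?Y"
      proof (cases "0 < mark_count ?B k \<omega>")
        case True
        have "mark_count ?A k \<omega> \<le> real k * (contact_prob - \<epsilon>)"
          using tree_degree_ge[OF True] \<omega> by simp
        also have "\<dots> \<le> real k * (prob {\<omega> \<in> space M. mark 1 \<omega> \<in> ?A} - \<epsilon> / 2)"
          using n by (intro mult_left_mono) (auto simp: \<delta>_def)
        finally show ?thesis using \<omega> by (simp add: algebra_simps)
      next
        case False
        then show ?thesis using \<omega> by (simp add: r_def)
      qed
    qed
    have "prob {\<omega> \<in> space M. real (tree_degree k \<omega>) \<le> real k * (contact_prob - \<epsilon>)} \<le> prob (?X \<union> ?Y)"
      by (rule finite_measure_mono[OF sub]) measurable
    also have "\<dots> \<le> prob ?X + prob ?Y"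
      by (rule measure_Un_le) measurable
    also have "\<dots> \<le> exp (- 2 * (real k * (\<epsilon> / 2))\<^sup>2 / real k) + exp (- 2 * (real k * r)\<^sup>2 / real k)"
      using k \<epsilon> r by (intro add_mono mark_count_le) auto
    also have "\<dots> = exp (- (\<epsilon>\<^sup>2 / 2) * real k) + exp (- (2 * r\<^sup>2) * real k)"
      using k by (simp add: power2_eq_square field_simps)
    finally show ?thesis .
  qed
  show ?thesis
  proof (rule tendsto_sandwich[OF _ _ tendsto_const])
    show "\<forall>\<^sub>F k in sequentially. prob {\<omega> \<in> space M. real (tree_degree k \<omega>) \<le> real k * (contact_prob - \<epsilon>)}
      \<le> exp (- (\<epsilon>\<^sup>2 / 2) * real k) + exp (- (2 * r\<^sup>2) * real k)"
      using eventually_ge_at_top[of 1] by eventually_elim (rule le)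
    have lim: "(\<lambda>k. exp (- a * real k)) \<longlonglongrightarrow> 0" if "0 < a" for a
      using that by real_asymp
    show "(\<lambda>k. exp (- (\<epsilon>\<^sup>2 / 2) * real k) + exp (- (2 * r\<^sup>2) * real k)) \<longlonglongrightarrow> 0"
      using \<epsilon> r by (intro tendsto_add_zero lim) auto
  qed auto
qed

lemma tree_degree_not_large:
  assumes \<epsilon>: "0 < \<epsilon>"
  shows "(\<lambda>k. prob {\<omega> \<in> space M. real k * (contact_prob + \<epsilon>) \<le> real (tree_degree k \<omega>)}) \<longlonglongrightarrow> 0"
proof (rule tendsto_sandwich[OF _ _ tendsto_const])
  let ?A = "{(v::real, e). e < v}"
  \<comment> \<open>Half of the excess k \<epsilon> absorbs the additive 1 in the degree; the other
    half is the deviation.\<close>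
  have "\<forall>\<^sub>F k in sequentially. 1 \<le> real k * (\<epsilon> / 2)"
    using \<epsilon> by real_asymp
  then show "\<forall>\<^sub>F k in sequentially. prob {\<omega> \<in> space M. real k * (contact_prob + \<epsilon>) \<le> real (tree_degree k \<omega>)}
      \<le> exp (- (\<epsilon>\<^sup>2 / 2) * real k)"
    using eventually_ge_at_top[of 1]
  proof eventually_elim
    case (elim k)
    have "prob {\<omega> \<in> space M. real k * (contact_prob + \<epsilon>) \<le> real (tree_degree k \<omega>)}
      \<le> prob {\<omega> \<in> space M. real k * prob {\<omega> \<in> space M. mark 1 \<omega> \<in> ?A} + real k * (\<epsilon> / 2) \<le> mark_count ?A k \<omega>}"
    proof (rule finite_measure_mono_AE)
      show "AE \<omega> in M. \<omega> \<in> {\<omega> \<in> space M. real k * (contact_prob + \<epsilon>) \<le> real (tree_degree k \<omega>)} \<longrightarrow>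
        \<omega> \<in> {\<omega> \<in> space M. real k * prob {\<omega> \<in> space M. mark 1 \<omega> \<in> ?A} + real k * (\<epsilon> / 2) \<le> mark_count ?A k \<omega>}"
        using AE_tree_degree_le
      proof eventually_elim
        case le: (elim \<omega>)
        then have "real (tree_degree k \<omega>) \<le> 1 + mark_count ?A k \<omega>"
          using elim by blast
        with elim show ?case
          by (auto simp: contact_prob_def algebra_simps)
      qed
    qed measurable
    also have "\<dots> \<le> exp (- 2 * (real k * (\<epsilon> / 2))\<^sup>2 / real k)"
      using elim \<epsilon> by (intro mark_count_ge) auto
    also have "\<dots> = exp (- (\<epsilon>\<^sup>2 / 2) * real k)"
      using elim by (simp add: power2_eq_square field_simps)
    finally show ?case .
  qed
  show "(\<lambda>k. exp (- (\<epsilon>\<^sup>2 / 2) * real k)) \<longlonglongrightarrow> 0"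
    using \<epsilon> by real_asymp
qed auto

lemma tree_degree_concentration:
  assumes \<epsilon>: "0 < \<epsilon>"
  shows "(\<lambda>k. prob {\<omega> \<in> space M. \<epsilon> < \<bar>real (tree_degree k \<omega>) / (contact_prob * real k) - 1\<bar>}) \<longlonglongrightarrow> 0"
proof (rule tendsto_sandwich[OF _ _ tendsto_const])
  let ?p = contact_prob
  let ?X = "\<lambda>k. {\<omega> \<in> space M. real (tree_degree k \<omega>) \<le> real k * (?p - ?p * \<epsilon>)}"
  let ?Y = "\<lambda>k. {\<omega> \<in> space M. real k * (?p + ?p * \<epsilon>) \<le> real (tree_degree k \<omega>)}"
  \<comment> \<open>A relative error \<epsilon> is an absolute error p \<epsilon> in the ratio of
    degree to k.\<close>
  have p\<epsilon>: "0 < ?p * \<epsilon>" using contact_prob_pos \<epsilon> by simp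
  show "\<forall>\<^sub>F k in sequentially. prob {\<omega> \<in> space M. \<epsilon> < \<bar>real (tree_degree k \<omega>) / (?p * real k) - 1\<bar>}
      \<le> prob (?X k) + prob (?Y k)"
    using eventually_gt_at_top[of 0]
  proof eventually_elim
    case (elim k)
    have "{\<omega> \<in> space M. \<epsilon> < \<bar>real (tree_degree k \<omega>) / (?p * real k) - 1\<bar>} \<subseteq> ?X k \<union> ?Y k"
    proof safe
      fix \<omega> assume "\<epsilon> < \<bar>real (tree_degree k \<omega>) / (?p * real k) - 1\<bar>"
        and "\<not> real k * (?p + ?p * \<epsilon>) \<le> real (tree_degree k \<omega>)"
      with elim contact_prob_pos show "real (tree_degree k \<omega>) \<le> real k * (?p - ?p * \<epsilon>)"
        by (auto simp: abs_if field_simps split: if_splits)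
    qed
    then have "prob {\<omega> \<in> space M. \<epsilon> < \<bar>real (tree_degree k \<omega>) / (?p * real k) - 1\<bar>} \<le> prob (?X k \<union> ?Y k)"
      by (rule finite_measure_mono) measurable
    also have "\<dots> \<le> prob (?X k) + prob (?Y k)"
      by (rule measure_Un_le) measurable
    finally show ?case .
  qed
  show "(\<lambda>k. prob (?X k) + prob (?Y k)) \<longlonglongrightarrow> 0"
    by (intro tendsto_add_zero tree_degree_not_small tree_degree_not_large p\<epsilon>)
qed auto

text \<open>The witness for the o(1) term, obtained by solving for it. On D = 0 division by zero
  yields the value -1, and the product formula is then claimed only for D > 0.\<close>

definition relative_error :: "'a \<Rightarrow> real" where
  "relative_error \<omega> = real (tree_degree (D \<omega>) \<omega>) / (contact_prob * real (D \<omega>)) - 1"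

lemma relative_error_measurable [measurable]: "relative_error \<in> borel_measurable M"
  unfolding relative_error_def[abs_def] by measurable

lemma tree_degree_eq_relative_error:
  assumes "0 < D \<omega>"
  shows "real (tree_degree (D \<omega>) \<omega>) = contact_prob * real (D \<omega>) * (1 + relative_error \<omega>)"
  using assms contact_prob_pos by (simp add: relative_error_def)

text \<open>On D = k the error is a function of \<open>tree_degree k\<close>, so by independence the
  conditional probability is unconditional, and the concentration for fixed k applies.\<close>

lemma relative_error_conditional:
  assumes \<epsilon>: "0 < \<epsilon>"
  shows "((\<lambda>k. cond_prob M (\<lambda>\<omega>. \<bar>relative_error \<omega>\<bar> > \<epsilon>) (\<lambda>\<omega>. D \<omega> = k)) \<longlongrightarrow> 0)
    (inf sequentially (principal {k. 0 < prob {\<omega> \<in> space M. D \<omega> = k}}))"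
proof (rule Lim_transform_eventually)
  let ?F = "inf sequentially (principal {k. 0 < prob {\<omega> \<in> space M. D \<omega> = k}})"
  let ?err = "\<lambda>k n. \<bar>real n / (contact_prob * real k) - 1\<bar>"
  show "((\<lambda>k. prob {\<omega> \<in> space M. \<epsilon> < ?err k (tree_degree k \<omega>)}) \<longlongrightarrow> 0) ?F"
    by (rule tendsto_mono[OF inf_le1 tree_degree_concentration[OF \<epsilon>]])
  show "\<forall>\<^sub>F k in ?F. prob {\<omega> \<in> space M. \<epsilon> < ?err k (tree_degree k \<omega>)}
      = cond_prob M (\<lambda>\<omega>. \<bar>relative_error \<omega>\<bar> > \<epsilon>) (\<lambda>\<omega>. D \<omega> = k)"
    unfolding eventually_inf_principal
  proof (intro always_eventually allI impI)
    fix k assume k: "k \<in> {k. 0 < prob {\<omega> \<in> space M. D \<omega> = k}}"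
    have "prob {\<omega> \<in> space M. \<bar>relative_error \<omega>\<bar> > \<epsilon> \<and> D \<omega> = k}
        = prob {\<omega> \<in> space M. D \<omega> = k \<and> tree_degree k \<omega> \<in> {n. \<epsilon> < ?err k n}}"
      by (intro arg_cong[where f = prob]) (auto simp: relative_error_def)
    with k indep_degree_tree_degree[of k "{n. \<epsilon> < ?err k n}"]
    show "prob {\<omega> \<in> space M. \<epsilon> < ?err k (tree_degree k \<omega>)}
        = cond_prob M (\<lambda>\<omega>. \<bar>relative_error \<omega>\<bar> > \<epsilon>) (\<lambda>\<omega>. D \<omega> = k)"
      by (simp add: cond_prob_def)
  qed
qed

section \<open>Transfer of the tail from D to the tree degree\<close>

text \<open>Splits over the values of \<open>D\<close>, applies the product formula to each, and
  sums: a uniform bound for frozen degrees becomes one for the random degree.\<close>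

lemma prob_tree_degree_D_ge:
  assumes "\<And>k. k \<in> K \<Longrightarrow> c \<le> prob {\<omega> \<in> space M. tree_degree k \<omega> \<in> S}"
  shows "c * prob {\<omega> \<in> space M. D \<omega> \<in> K}
    \<le> prob {\<omega> \<in> space M. D \<omega> \<in> K \<and> tree_degree (D \<omega>) \<omega> \<in> S}"
proof -
  let ?A = "\<lambda>k. {\<omega> \<in> space M. D \<omega> = k \<and> D \<omega> \<in> K}"
  let ?B = "\<lambda>k. {\<omega> \<in> space M. D \<omega> = k \<and> D \<omega> \<in> K \<and> tree_degree (D \<omega>) \<omega> \<in> S}"
  have [measurable]: "{\<omega> \<in> space M. D \<omega> \<in> K} \<in> events" "{\<omega> \<in> space M. tree_degree (D \<omega>) \<omega> \<in> S} \<in> events"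
    by measurable
  have "(\<lambda>k. prob (?A k)) sums prob (\<Union>k. ?A k)" "(\<lambda>k. prob (?B k)) sums prob (\<Union>k. ?B k)"
    by (intro finite_measure_UNION; auto simp: disjoint_family_on_def)+
  moreover have "(\<Union>k. ?A k) = {\<omega> \<in> space M. D \<omega> \<in> K}"
    "(\<Union>k. ?B k) = {\<omega> \<in> space M. D \<omega> \<in> K \<and> tree_degree (D \<omega>) \<omega> \<in> S}"
    by auto
  ultimately have sums: "(\<lambda>k. c * prob (?A k)) sums (c * prob {\<omega> \<in> space M. D \<omega> \<in> K})"
    "(\<lambda>k. prob (?B k)) sums prob {\<omega> \<in> space M. D \<omega> \<in> K \<and> tree_degree (D \<omega>) \<omega> \<in> S}"
    by (auto intro: sums_mult)
  have "c * prob (?A k) \<le> prob (?B k)" for k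
  proof (cases "k \<in> K")
    case True
    have "c * prob (?A k) = c * prob {\<omega> \<in> space M. D \<omega> = k}"
      using True by (intro arg_cong[where f = "\<lambda>X. c * prob X"]) auto
    also have "\<dots> \<le> prob {\<omega> \<in> space M. tree_degree k \<omega> \<in> S} * prob {\<omega> \<in> space M. D \<omega> = k}"
      using assms[OF True] by (intro mult_right_mono) auto
    also have "\<dots> = prob {\<omega> \<in> space M. D \<omega> = k \<and> tree_degree k \<omega> \<in> S}"
      by (simp add: indep_degree_tree_degree)
    also have "\<dots> = prob (?B k)"
      using True by (intro arg_cong[where f = prob]) auto
    finally show ?thesis .
  next
    case False
    then have "?A k = {}" by auto
    then show ?thesis by (simp only: measure_empty mult_zero_right measure_nonneg)
  qed
  from sums_le[OF this sums] show ?thesis .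
qed

lemma mark_count_mono:
  assumes "k \<le> m"
  shows "mark_count A k \<omega> \<le> mark_count A m \<omega>"
  unfolding mark_count_def using assms by (intro sum_mono2) auto

definition degree_tail :: "real \<Rightarrow> real" where
  "degree_tail x = prob {\<omega> \<in> space M. x < real (D \<omega>)}"

definition tree_degree_tail :: "real \<Rightarrow> real" where
  "tree_degree_tail x = prob {\<omega> \<in> space M. x < real (tree_degree (D \<omega>) \<omega>)}"

lemma antimono_degree_tail: "antimono degree_tail"
  and antimono_tree_degree_tail: "antimono tree_degree_tail"
  unfolding degree_tail_def[abs_def] tree_degree_tail_def[abs_def]
  by (auto intro!: antimonoI finite_measure_mono)

lemma eventually_le_mult_at_top:
  fixes a c :: real
  assumes "0 < c"
  shows "\<forall>\<^sub>F x in at_top. a \<le> c * x"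
  using assms by real_asymp

text \<open>All degrees D \<le> y are dominated by the count at m, the integer part of y = (1 -
  \<eta>) x / p, so a single deviation event suffices and no union over the values of
  \<open>D\<close> is taken.\<close>

lemma tree_degree_tail_le:
  assumes \<eta>: "0 < \<eta>" "\<eta> < 1"
  shows "\<exists>c>0. \<forall>\<^sub>F x in at_top.
    tree_degree_tail x \<le> degree_tail ((1 - \<eta>) * inverse contact_prob * x) + exp (- c * x)"
proof (intro exI conjI)
  let ?p = contact_prob and ?A = "{(v::real, e). e < v}"
  note p = contact_prob_pos
  \<comment> \<open>The Hoeffding exponent for deviation \<eta> x / 2 over at most x / p
    summands.\<close>
  show "0 < \<eta>\<^sup>2 * ?p / 2" using \<eta> p by simp
  have "\<forall>\<^sub>F x in at_top. 1 \<le> (1 - \<eta>) * inverse ?p * x"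
    using \<eta> p by (intro eventually_le_mult_at_top) auto
  \<comment> \<open>Since m p \<le> (1 - \<eta>) x, there is a gap of \<eta> x below x: half of it
    absorbs the additive 1, half is the deviation.\<close>
  moreover have "\<forall>\<^sub>F x in at_top. 1 \<le> (\<eta> / 2) * x"
    using \<eta> by real_asymp
  ultimately show "\<forall>\<^sub>F x in at_top.
    tree_degree_tail x \<le> degree_tail ((1 - \<eta>) * inverse ?p * x) + exp (- (\<eta>\<^sup>2 * ?p / 2) * x)"
    using eventually_gt_at_top[of 0]
  proof eventually_elim
    case (elim x)
    define y where "y = (1 - \<eta>) * inverse ?p * x"
    define m where "m = nat \<lfloor>y\<rfloor>"
    have m: "1 \<le> m" "real m \<le> y" using elim(1) unfolding m_def y_def[symmetric] by linarith+
    have m_max: "k \<le> m" if "real k \<le> y" for k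
      using that by (simp add: m_def le_nat_floor)
    have py: "y * ?p = (1 - \<eta>) * x" using p by (simp add: y_def)
    have mp: "real m * ?p \<le> (1 - \<eta>) * x"
      using m(2) p py by (metis less_imp_le mult_right_mono)
    have "(1 - \<eta>) * x \<le> 1 * x" using \<eta> elim(3) by (intro mult_right_mono) auto
    with mp have mx: "real m \<le> x / ?p" using p by (simp add: field_simps)
    let ?B = "{\<omega> \<in> space M. real m * prob {\<omega> \<in> space M. mark 1 \<omega> \<in> ?A} + (\<eta> / 2) * x \<le> mark_count ?A m \<omega>}"
    have "tree_degree_tail x \<le> prob ({\<omega> \<in> space M. y < real (D \<omega>)} \<union> ?B)"
      unfolding tree_degree_tail_def
    proof (rule finite_measure_mono_AE)
      show "AE \<omega> in M. \<omega> \<in> {\<omega> \<in> space M. x < real (tree_degree (D \<omega>) \<omega>)} \<longrightarrow>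
          \<omega> \<in> {\<omega> \<in> space M. y < real (D \<omega>)} \<union> ?B"
        using AE_tree_degree_le
      proof eventually_elim
        case le: (elim \<omega>)
        show ?case
        proof (intro impI UnCI)
          assume \<omega>: "\<omega> \<in> {\<omega> \<in> space M. x < real (tree_degree (D \<omega>) \<omega>)}"
            and "\<omega> \<notin> ?B"
          show "\<omega> \<in> {\<omega> \<in> space M. y < real (D \<omega>)}"
          proof (rule ccontr)
            assume "\<omega> \<notin> {\<omega> \<in> space M. y < real (D \<omega>)}"
            with \<omega> have "D \<omega> \<le> m" by (intro m_max) auto
            have "x < 1 + mark_count ?A m \<omega>"
            proof (cases "1 \<le> D \<omega>")
              case True
              then have "real (tree_degree (D \<omega>) \<omega>) \<le> 1 + mark_count ?A (D \<omega>) \<omega>"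
                using le by blast
              with \<omega> mark_count_mono[OF \<open>D \<omega> \<le> m\<close>, of ?A \<omega>] show ?thesis by simp
            next
              \<comment> \<open>The locale does not exclude D = 0. The empty sum then gives degree
                1, and the claim follows from x < 1.\<close>
              case False
              then have "tree_degree (D \<omega>) \<omega> = 1"
                by (simp add: tree_degree_def spt_degree_def)
              moreover have "0 \<le> mark_count ?A m \<omega>"
                unfolding mark_count_def by (intro sum_nonneg) auto
              ultimately show ?thesis using \<omega> by simp
            qed
            with mp elim(2) have "\<omega> \<in> ?B"
              using \<omega> by (simp add: contact_prob_def algebra_simps)
            with \<open>\<omega> \<notin> ?B\<close> show False ..
          qed
        qed
      qed
    qed measurable
    also have "\<dots> \<le> degree_tail y + prob ?B"
      unfolding degree_tail_def by (rule measure_Un_le) measurable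
    also have "prob ?B \<le> exp (- 2 * ((\<eta> / 2) * x)\<^sup>2 / real m)"
      using \<eta> elim m by (intro mark_count_ge) auto
    also have "\<dots> \<le> exp (- (\<eta>\<^sup>2 * ?p / 2) * x)"
    proof -
      have "(\<eta>\<^sup>2 * ?p / 2) * x = 2 * ((\<eta> / 2) * x)\<^sup>2 / (x / ?p)"
        using elim(3) p by (simp add: power2_eq_square field_simps)
      also have "\<dots> \<le> 2 * ((\<eta> / 2) * x)\<^sup>2 / real m"
        using m mx elim(3) p by (intro divide_left_mono mult_pos_pos) auto
      finally show ?thesis by simp
    qed
    finally show ?case by (simp add: y_def)
  qed
qed

lemma tree_degree_tail_ge:
  assumes \<eta>: "0 < \<eta>" "\<eta> < 1"
  shows "\<forall>\<^sub>F x in at_top.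
    (1 - \<eta>) * degree_tail ((1 + \<eta>) * inverse contact_prob * x) \<le> tree_degree_tail x"
proof -
  let ?p = contact_prob
  note p = contact_prob_pos
  \<comment> \<open>Chosen so that p - \<epsilon> = p / (1 + \<eta>), which makes the threshold k (p
    - \<epsilon>) equal to x at k = y.\<close>
  define \<epsilon> where "\<epsilon> = ?p - ?p / (1 + \<eta>)"
  have "0 < \<epsilon>" using \<eta> p by (simp add: \<epsilon>_def field_simps)
  have "\<forall>\<^sub>F k in sequentially. prob {\<omega> \<in> space M. real (tree_degree k \<omega>) \<le> real k * (?p - \<epsilon>)} < \<eta>"
    using \<eta> by (intro order_tendstoD(2)[OF tree_degree_not_small[OF \<open>0 < \<epsilon>\<close>]]) auto
  then obtain K where K: "\<And>k. k \<ge> K \<Longrightarrow> prob {\<omega> \<in> space M. real (tree_degree k \<omega>) \<le> real k * (?p / (1 + \<eta>))} < \<eta>"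
    by (auto simp: eventually_sequentially \<epsilon>_def)
  have "\<forall>\<^sub>F x in at_top. real K \<le> (1 + \<eta>) * inverse ?p * x"
    using \<eta> p by (intro eventually_le_mult_at_top) auto
  then show ?thesis
  proof eventually_elim
    case (elim x)
    define y where "y = (1 + \<eta>) * inverse ?p * x"
    have "1 - \<eta> \<le> prob {\<omega> \<in> space M. tree_degree k \<omega> \<in> {n. x < real n}}" if k: "k \<in> {k. y < real k}" for k
    proof -
      have "k \<ge> K" using k elim by (simp add: y_def)
      have "1 + \<eta> \<noteq> 0" using \<eta> by simp
      then have "x = y * (?p / (1 + \<eta>))" using p by (simp add: y_def)
      also have "\<dots> \<le> real k * (?p / (1 + \<eta>))"
        using k p \<eta> by (intro mult_right_mono) auto
      finally have "x \<le> real k * (?p / (1 + \<eta>))" .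
      then have "prob {\<omega> \<in> space M. real (tree_degree k \<omega>) \<le> x}
          \<le> prob {\<omega> \<in> space M. real (tree_degree k \<omega>) \<le> real k * (?p / (1 + \<eta>))}"
        by (intro finite_measure_mono) auto
      with K[OF \<open>k \<ge> K\<close>] have "1 - \<eta> \<le> 1 - prob {\<omega> \<in> space M. real (tree_degree k \<omega>) \<le> x}"
        by simp
      also have "\<dots> = prob {\<omega> \<in> space M. \<not> real (tree_degree k \<omega>) \<le> x}"
        by (rule prob_neg[symmetric]) measurable
      finally show ?thesis by (simp add: not_le)
    qed
    from prob_tree_degree_D_ge[of "{k. y < real k}" "1 - \<eta>" "{n. x < real n}", OF this]
    have "(1 - \<eta>) * degree_tail y
        \<le> prob {\<omega> \<in> space M. D \<omega> \<in> {k. y < real k} \<and> tree_degree (D \<omega>) \<omega> \<in> {n. x < real n}}"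
      by (simp add: degree_tail_def)
    also have "\<dots> \<le> tree_degree_tail x"
      unfolding tree_degree_tail_def by (intro finite_measure_mono) auto
    finally show ?case by (simp add: y_def)
  qed
qed

lemma regularly_varying_tree_degree_tail:
  assumes "regularly_varying \<rho> degree_tail" "\<rho> < 0"
  shows "regularly_varying \<rho> tree_degree_tail"
  using contact_prob_pos
  by (intro regularly_varying_sandwich[OF assms(1) antimono_degree_tail assms(2), of "inverse contact_prob"]
      tree_degree_tail_le tree_degree_tail_ge) auto

end

section \<open>The limiting degree\<close>

lemma (in prob_space) one_minus_cdf_nat:
  assumes [measurable]: "X \<in> measurable M (count_space UNIV)"
  shows "1 - cdf (distr M borel (\<lambda>\<omega>. real (X \<omega>))) x = prob {\<omega> \<in> space M. x < real (X \<omega>)}"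
proof -
  have "cdf (distr M borel (\<lambda>\<omega>. real (X \<omega>))) x = prob {\<omega> \<in> space M. real (X \<omega>) \<le> x}"
    unfolding cdf_def by (subst measure_distr) (auto simp: vimage_def Int_def conj_commute)
  moreover have "prob {\<omega> \<in> space M. \<not> real (X \<omega>) \<le> x} = 1 - prob {\<omega> \<in> space M. real (X \<omega>) \<le> x}"
    by (rule prob_neg) measurable
  ultimately show ?thesis by (simp add: not_le)
qed

text \<open>The mean of a variable with values in the naturals is the sum of its tails, which
  converges for an index below -1.\<close>

lemma (in prob_space) integrable_distr_of_regularly_varying_tail:
  fixes X :: "'a \<Rightarrow> nat"
  assumes [measurable]: "X \<in> measurable M (count_space UNIV)"
    and T: "regularly_varying \<rho> (\<lambda>x. prob {\<omega> \<in> space M. x < real (X \<omega>)})" and \<rho>: "\<rho> < - 1"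
  shows "integrable (distr M (count_space UNIV) X) real"
proof -
  let ?T = "\<lambda>x. prob {\<omega> \<in> space M. x < real (X \<omega>)}"
  have "antimono ?T"
    by (auto intro!: antimonoI finite_measure_mono)
  then have sm: "summable (\<lambda>n. ?T (real n))"
    by (intro summable_regularly_varying[OF T _ _ \<rho>]) auto
  have "(\<integral>\<^sup>+\<omega>. ennreal (real (X \<omega>)) \<partial>M) = (\<Sum>t. emeasure M {\<omega> \<in> space M. t < X \<omega>})"
    unfolding ennreal_of_nat_eq_real_of_nat[symmetric] by (rule nn_integral_nat_function) measurable
  also have "\<dots> = (\<Sum>t. ennreal (?T (real t)))"
    by (simp add: emeasure_eq_measure)
  also have "\<dots> \<noteq> \<infinity>"
    unfolding infinity_ennreal_def by (rule ennreal_suminf_neq_top[OF sm]) simp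
  finally have "integrable M (\<lambda>\<omega>. real (X \<omega>))"
    by (intro integrableI_nonneg) (auto simp: less_top)
  then show ?thesis by (subst integrable_distr_eq) auto
qed

theorem corollary2p10:
  fixes M :: "'a measure"
    and D :: "'a \<Rightarrow> nat"
    and V E :: "nat \<Rightarrow> 'a \<Rightarrow> real"
    and \<tau> :: real
    and L :: "real \<Rightarrow> real"
  defines "\<mu> \<equiv> distr M (count_space UNIV) D"
    and "p \<equiv> prob_V_gt_E (distr M (count_space UNIV) D)"
    and "Dhat \<equiv> (\<lambda>\<omega>. spt_degree (D \<omega>) (\<lambda>i. V i \<omega>) (\<lambda>i. E i \<omega>))"
  assumes "prob_space M"
    and "D \<in> measurable M (count_space UNIV)"
    and "AE \<omega> in M. 2 \<le> D \<omega>"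
    and "2 < \<tau>" and "\<tau> < 3"
    and "slowly_varying L"
    and "\<And>x. 0 < x \<Longrightarrow> 1 - cdf (distr M borel (\<lambda>\<omega>. real (D \<omega>))) x = x powr (1 - \<tau>) * L x"
    \<comment> \<open>\<open>D\<close>, \<open>V\<^sub>1, V\<^sub>2, \<dots>\<close>, \<open>E\<^sub>1, E\<^sub>2, \<dots>\<close> are mutually independent\<close>
    and "prob_space.indep_vars M (\<lambda>_. borel)
           (case_sum (\<lambda>_::unit. \<lambda>\<omega>. real (D \<omega>)) (case_sum V E))
           ({()} <+> {1..} <+> {1..})"
    and "\<And>i. 1 \<le> i \<Longrightarrow> distr M borel (\<lambda>\<omega>. ennreal (V i \<omega>)) = V_law \<mu>"
    and "\<And>i. 1 \<le> i \<Longrightarrow> distr M borel (E i) = exp1"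
  shows "(\<exists>R. R \<in> borel_measurable M \<and>
             (AE \<omega> in M. real (Dhat \<omega>) = p * real (D \<omega>) * (1 + R \<omega>)) \<and>
             (\<forall>\<epsilon>>0. ((\<lambda>k. cond_prob M (\<lambda>\<omega>. \<bar>R \<omega>\<bar> > \<epsilon>) (\<lambda>\<omega>. D \<omega> = k)) \<longlongrightarrow> 0)
                      (inf sequentially (principal {k. measure M {\<omega> \<in> space M. D \<omega> = k} > 0})))) \<and>
         (\<exists>Lhat. slowly_varying Lhat \<and>
           (\<forall>x>0. 1 - cdf (distr M borel (\<lambda>\<omega>. real (Dhat \<omega>))) x = x powr (1 - \<tau>) * Lhat x))"
proof -
  note D [measurable] = assms(5) and indep = assms(11) and ennreal_V_law = assms(12) and E_exp1 = assms(13)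
  interpret prob_space M by fact
  have V [measurable]: "V i \<in> borel_measurable M" if "1 \<le> i" for i
    using indep that by (force simp: indep_vars_def)
  let ?T = "\<lambda>x. prob {\<omega> \<in> space M. x < real (D \<omega>)}"
  have T: "regularly_varying (1 - \<tau>) ?T"
    by (rule regularly_varying_powr_times[OF assms(9)])
      (use assms(10) in \<open>simp only: one_minus_cdf_nat[OF D]\<close>)
  interpret law: degree_law \<mu>
  proof -
    interpret \<mu>: prob_space \<mu>
      unfolding \<mu>_def by (rule prob_space_distr) measurable
    show "degree_law \<mu>"
    proof
      show "sets \<mu> = UNIV" by (simp add: \<mu>_def)
      show "AE k in \<mu>. 2 \<le> k" using assms(6) unfolding \<mu>_def by (subst AE_distr_iff) auto
      show "integrable \<mu> real" unfolding \<mu>_def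
        using assms(7) by (intro integrable_distr_of_regularly_varying_tail[OF _ T]) auto
    qed
  qed
  \<comment> \<open>The series could be infinite a priori; that a real valued V has its law rules
    this out.\<close>
  have AE_V: "AE v in V_law \<mu>. v < \<infinity>"
    unfolding ennreal_V_law[OF order_refl, symmetric] by (subst AE_distr_iff) auto
  have V_pos: "AE \<omega> in M. 0 < V i \<omega>" if i: "1 \<le> i" for i
  proof -
    have "AE v in distr M borel (\<lambda>\<omega>. ennreal (V i \<omega>)). 0 < v"
      by (subst ennreal_V_law[OF i]) (rule law.AE_V_law_pos)
    then show ?thesis using V[OF i] by (subst (asm) AE_distr_iff) auto
  qed
  \<comment> \<open>\<open>ennreal\<close> erases negative values, so the law of V i is recovered
    only after almost sure positivity is known.\<close>
  have V_distr: "distr M borel (V i) = distr (V_law \<mu>) borel enn2real" if i: "1 \<le> i" for i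
  proof -
    have "distr (V_law \<mu>) borel enn2real = distr M borel (\<lambda>\<omega>. enn2real (ennreal (V i \<omega>)))"
      using i by (subst ennreal_V_law[OF i, symmetric], subst distr_distr) (auto simp: comp_def)
    also have "\<dots> = distr M borel (V i)"
      using V_pos[OF i] i by (intro distr_cong_AE) (auto elim!: eventually_mono)
    finally show ?thesis ..
  qed
  interpret marked_degree M D V E
  proof
    show "distr M borel (V i) = distr M borel (V 1)" if "1 \<le> i" for i
      using V_distr[OF that] V_distr[OF order_refl] by simp
    show "AE \<omega> in M. 0 < V 1 \<omega>" by (rule V_pos) simp
    fix \<delta> :: real assume \<delta>: "0 < \<delta>"
    have "0 < measure (V_law \<mu>) {..<ennreal \<delta>}"
      by (rule law.measure_V_law_lessThan_pos[OF AE_V \<delta>])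
    also have "\<dots> = measure (distr M borel (\<lambda>\<omega>. ennreal (V 1 \<omega>))) {..<ennreal \<delta>}"
      by (subst ennreal_V_law) auto
    also have "\<dots> = prob {\<omega> \<in> space M. ennreal (V 1 \<omega>) < ennreal \<delta>}"
      by (subst measure_distr) (auto simp: vimage_def Int_def conj_commute)
    also have "\<dots> = prob {\<omega> \<in> space M. V 1 \<omega> < \<delta>}"
      using V_pos[OF order_refl]
      by (intro prob_eq_AE) (auto elim!: eventually_mono simp: ennreal_less_iff)
    finally show "0 < prob {\<omega> \<in> space M. V 1 \<omega> < \<delta>}" .
  qed (use D indep E_exp1 in auto)
  have p: "p = contact_prob"
  proof -
    let ?N = "borel \<Otimes>\<^sub>M borel :: (ennreal \<times> real) measure"
    have law_pair: "V_law \<mu> \<Otimes>\<^sub>M exp1 = distr M ?N (\<lambda>\<omega>. (ennreal (V 1 \<omega>), E 1 \<omega>))"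
    proof -
      have "V_law \<mu> = distr (distr M borel (V 1)) borel ennreal"
        using ennreal_V_law[OF order_refl] by (subst distr_distr) (auto simp: comp_def)
      moreover have "exp1 = distr exp1 borel (\<lambda>x. x)"
        by (rule distr_id2[symmetric]) simp
      ultimately have "V_law \<mu> \<Otimes>\<^sub>M exp1
          = distr (distr M borel (V 1)) borel ennreal \<Otimes>\<^sub>M distr exp1 borel (\<lambda>x. x)"
        by simp
      also have "\<dots> = distr (distr M borel (V 1) \<Otimes>\<^sub>M exp1) ?N (\<lambda>(v, e). (ennreal v, e))"
        by (rule pair_measure_distr)
          (auto intro!: prob_space_imp_sigma_finite prob_space.prob_space_distr prob_space_exp1)
      also have "distr M borel (V 1) \<Otimes>\<^sub>M exp1 = distr M (borel \<Otimes>\<^sub>M borel) (mark 1)"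
        using indep_mark[OF order_refl] by (simp add: indep_var_distribution_eq E_exp1)
      also have "distr \<dots> ?N (\<lambda>(v, e). (ennreal v, e)) = distr M ?N (\<lambda>\<omega>. (ennreal (V 1 \<omega>), E 1 \<omega>))"
        by (subst distr_distr) (auto simp: comp_def)
      finally show ?thesis .
    qed
    have "{(v, e). ennreal e < v} \<in> sets ?N"
    proof -
      have "{x \<in> space ?N. ennreal (snd x) < fst x} \<in> sets ?N" by measurable
      then show ?thesis by (simp add: space_pair_measure split_beta')
    qed
    then have "p = prob {\<omega> \<in> space M. ennreal (E 1 \<omega>) < ennreal (V 1 \<omega>)}"
      unfolding p_def prob_V_gt_E_def \<mu>_def[symmetric] law_pair
      by (subst measure_distr) (auto simp: vimage_def Int_def conj_commute)
    \<comment> \<open>The comparison in \<open>ennreal\<close> agrees with the real one where E 1 is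
      nonnegative, hence almost surely.\<close>
    also have "\<dots> = contact_prob"
      unfolding contact_prob_def using AE_pos
      by (intro prob_eq_AE) (auto elim!: eventually_mono simp: ennreal_less_iff)
    finally show ?thesis .
  qed
  have Dhat: "Dhat = (\<lambda>\<omega>. tree_degree (D \<omega>) \<omega>)"
    by (simp add: Dhat_def tree_degree_def[abs_def])
  show ?thesis
  proof (intro conjI exI allI impI)
    show "relative_error \<in> borel_measurable M" by measurable
    show "AE \<omega> in M. real (Dhat \<omega>) = p * real (D \<omega>) * (1 + relative_error \<omega>)"
      using assms(6) unfolding Dhat p
      by eventually_elim (rule tree_degree_eq_relative_error, simp)
    show "((\<lambda>k. cond_prob M (\<lambda>\<omega>. \<epsilon> < \<bar>relative_error \<omega>\<bar>) (\<lambda>\<omega>. D \<omega> = k)) \<longlongrightarrow> 0)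
        (inf sequentially (principal {k. 0 < prob {\<omega> \<in> space M. D \<omega> = k}}))" if "0 < \<epsilon>" for \<epsilon>
      by (rule relative_error_conditional[OF that])
    have "regularly_varying (1 - \<tau>) tree_degree_tail"
      using T assms(7) by (intro regularly_varying_tree_degree_tail) (auto simp: degree_tail_def[abs_def])
    moreover have "tree_degree_tail \<in> borel_measurable borel"
    proof -
      \<comment> \<open>The sign change makes the function increasing, and monotone functions are
        Borel.\<close>
      have "(\<lambda>x. - tree_degree_tail x) \<in> borel_measurable borel"
        using antimono_tree_degree_tail by (intro borel_measurable_mono) (auto simp: monotone_def)
      then show ?thesis by simp
    qed
    ultimately show "slowly_varying (\<lambda>x. x powr (- (1 - \<tau>)) * tree_degree_tail x)"
      by (rule slowly_varying_of_regularly_varying)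
    fix x :: real assume "0 < x"
    then show "1 - cdf (distr M borel (\<lambda>\<omega>. real (Dhat \<omega>))) x
        = x powr (1 - \<tau>) * (x powr (- (1 - \<tau>)) * tree_degree_tail x)"
      by (simp add: Dhat one_minus_cdf_nat tree_degree_tail_def flip: powr_add mult.assoc)
  qed
qed

end
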